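(* For $d \geq 2$, every $d$-dimensional normal pseudomanifold is $(d + 1)$-rigid. For $d \geq 3$, the stacked $d$-spheres are exactly the minimally $(d + 1)$-rigid $d$-dimensional normal pseudomanifolds.
   Context: A simplicial complex is a finite set of finite sets closed under taking subsets; an element of size $i+1$ is an $i$-face (the empty set is the unique $(-1)$-face); 1-faces are edges; $V(X)$ is the vertex set; the dimension is the maximal face dimension. A pure $d$-dimensional complex has all maximal faces (facets) of dimension $d$. The link of a face $\alpha$ is $\mathrm{lk}_X(\alpha)=\{\beta\in X:\beta\cap\alpha=\emptyset,\ \alpha\cup\beta\in X\}$. $X$ is connected if its edge graph is connected. A $d$-dimensional normal pseudomanifold ($d\ge1$) is a pure $d$-dimensional simplicial complex in which every $(d-1)$-face lies in exactly two facets and the link of every face of dimension $\le d-2$ (including the empty face, whose link is $X$) is connected. (Gromov) rigidity: for a positive integer $q$, a $d$-dimensional simplicial complex $X$ is $q$-rigid if $X$ is connected and for every set $A\subseteq V(X)$ which is disjoint from at least one $d$-face of $X$, the number of edges of $X$ meeting $A$ is at least $q\cdot\#(A)$. An $n$-vertex $d$-dimensional complex $X$ is minimally $q$-rigid if it is $q$-rigid and has exactly $(n-d-1)q+\binom{d+1}{2}$ edges. The standard $d$-sphere $S^d_{d+2}$ is the complex of all proper subsets of a $(d+2)$-set. Starring a new vertex $v$ in a facet $\sigma$ of a pure $d$-dimensional complex replaces $\sigma$ by the facets $\tau\cup\{v\}$, $\tau$ a $(d-1)$-face of $\sigma$. A stacked $d$-sphere is a complex obtained from $S^d_{d+2}$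 by finitely many such starrings. *)

theory Defs
  imports Main
begin

definition simplicial_complex :: "'a set set \<Rightarrow> bool" where
  "simplicial_complex X \<longleftrightarrow> finite X \<and> (\<forall>\<sigma>\<in>X. finite \<sigma> \<and> (\<forall>\<tau>. \<tau> \<subseteq> \<sigma> \<longrightarrow> \<tau> \<in> X))"

definition vertices :: "'a set set \<Rightarrow> 'a set" where
  "vertices X = \<Union>X"

definition edges :: "'a set set \<Rightarrow> 'a set set" where
  "edges X = {e \<in> X. card e = 2}"

text \<open>Connectedness of the edge graph on the vertex set.\<close>
definition complex_connected :: "'a set set \<Rightarrow> bool" where
  "complex_connected X \<longleftrightarrow>
     (\<forall>u\<in>vertices X. \<forall>v\<in>vertices X. (u, v) \<in> {(x, y). {x, y} \<in> edges X}\<^sup>*)"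

definition link :: "'a set set \<Rightarrow> 'a set \<Rightarrow> 'a set set" where
  "link X \<alpha> = {\<beta> \<in> X. \<beta> \<inter> \<alpha> = {} \<and> \<alpha> \<union> \<beta> \<in> X}"

text \<open>Facets: maximal faces.\<close>
definition facets :: "'a set set \<Rightarrow> 'a set set" where
  "facets X = {\<sigma> \<in> X. \<forall>\<tau>\<in>X. \<sigma> \<subseteq> \<tau> \<longrightarrow> \<tau> = \<sigma>}"

text \<open>Pure of dimension d: nonempty (has a d-face) and every facet has d+1 vertices.\<close>
definition pure_dim :: "nat \<Rightarrow> 'a set set \<Rightarrow> bool" where
  "pure_dim d X \<longleftrightarrow> simplicial_complex X \<and> (\<exists>\<sigma>\<in>X. card \<sigma> = d + 1)
      \<and> (\<forall>\<sigma>\<in>facets X. card \<sigma> = d + 1)"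

definition normal_pseudomanifold :: "nat \<Rightarrow> 'a set set \<Rightarrow> bool" where
  "normal_pseudomanifold d X \<longleftrightarrow> d \<ge> 1 \<and> pure_dim d X
     \<and> (\<forall>\<tau>\<in>X. card \<tau> = d \<longrightarrow> card {\<sigma> \<in> X. card \<sigma> = d + 1 \<and> \<tau> \<subseteq> \<sigma>} = 2)
     \<and> (\<forall>\<alpha>\<in>X. card \<alpha> \<le> d - 1 \<longrightarrow> complex_connected (link X \<alpha>))"

text \<open>q-rigidity of a complex X of dimension d.\<close>
definition rigid :: "nat \<Rightarrow> nat \<Rightarrow> 'a set set \<Rightarrow> bool" where
  "rigid q d X \<longleftrightarrow> complex_connected X \<and>
     (\<forall>A. A \<subseteq> vertices X \<longrightarrow> (\<exists>\<sigma>\<in>X. card \<sigma> = d + 1 \<and> A \<inter> \<sigma> = {}) \<longrightarrow>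
          card {e \<in> edges X. e \<inter> A \<noteq> {}} \<ge> q * card A)"

definition minimally_rigid :: "nat \<Rightarrow> nat \<Rightarrow> 'a set set \<Rightarrow> bool" where
  "minimally_rigid q d X \<longleftrightarrow> rigid q d X \<and>
     int (card (edges X)) = (int (card (vertices X)) - int d - 1) * int q + int ((d + 1) choose 2)"

definition down_closure :: "'a set set \<Rightarrow> 'a set set" where
  "down_closure F = {\<rho>. \<exists>\<phi>\<in>F. \<rho> \<subseteq> \<phi>}"

text \<open>Starring a new vertex v in the facet \<sigma>.\<close>
definition star_in :: "'a set set \<Rightarrow> 'a set \<Rightarrow> 'a \<Rightarrow> nat \<Rightarrow> 'a set set" where
  "star_in X \<sigma> v d = down_closure ((facets X - {\<sigma>}) \<union> {\<tau> \<union> {v} | \<tau>. \<tau> \<subseteq> \<sigma> \<and> card \<tau> = d})"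

inductive stacked_sphere :: "nat \<Rightarrow> 'a set set \<Rightarrow> bool" for d where
  base: "finite S \<Longrightarrow> card S = d + 2 \<Longrightarrow> stacked_sphere d (Pow S - {S})"
| step: "stacked_sphere d X \<Longrightarrow> \<sigma> \<in> facets X \<Longrightarrow> v \<notin> vertices X \<Longrightarrow>
         stacked_sphere d (star_in X \<sigma> v d)"

end

theory Submission
  imports Defs
begin

text \<open>
  Rigidity is proved by induction on the dimension. On a surface it is an Euler characteristic
  count: for each dual component of the open star of \<open>A\<close>, the edges outside a dual spanning tree
  still connect the vertices of \<open>A\<close> to the rest, and the boundary of the component, being a
  nonempty cycle modulo 2, has at least three edges. In higher dimensions links are rigid by
  induction, hence so are their cones, the vertex stars; rigid complexes sharing a facet glue to
  a rigid complex, and \<open>X\<close> is the union of its stars taken along a connected order of the vertices.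

  If \<open>X\<close> is minimally rigid and \<open>d \<ge> 3\<close>, a rigid subcomplex contains every edge of \<open>X\<close> between its
  vertices. For the union of the stars of a connected vertex set, this says that the edge graph is
  chordal and that every 3-clique spans a triangle. A chordal graph has a simplicial vertex \<open>r\<close>. Its
  link is again minimally rigid but has a complete graph, so \<open>r\<close> has exactly \<open>d + 1\<close> neighbours and
  its link is the boundary of the simplex \<open>N\<close> on them. Either \<open>N\<close> is a face and \<open>X\<close> is a standard
  sphere, or \<open>X\<close> arises by starring \<open>r\<close> in the facet \<open>N\<close> of a smaller minimally rigid
  normal pseudomanifold.
\<close>

section \<open>Connectedness, links and strong connectedness\<close>

text \<open>The bound d \<ge> 3 in the second half comes from the links: stars are rigid because
  links are, and links need dimension at least 2 for this. Since every normal pseudomanifold is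
  already rigid, minimality is for them only an edge count, \<open>minimal_edges\<close>, and
  starring respects it in both directions: one new vertex, d + 1 new edges. A rigid subcomplex
  \<open>Y\<close> misses no edge because two lower bounds, one for the vertices of \<open>Y\<close>
  outside a facet and one for the vertices of \<open>X\<close> outside \<open>Y\<close>, already add
  up to the minimal total. In the surface count a dual tree has one triangle more than it has edges;
  this costs 3 in the estimate, and three boundary edges pay for exactly that. A boundary exists
  because of the face disjoint from \<open>A\<close>. A simplicial vertex has d + t neighbours with
  t > 0. Comparing the complete graph on them with the minimal count of the link leaves t choose 2 =
  0, hence t = 1. When a vertex is peeled off, the smaller complex is not yet known to be a normal
  pseudomanifold, so starring is studied as an equivalence over arbitrary complexes of bounded
  dimension.\<close>

lemma rtrancl_exit:
  "(a, b) \<in> R\<^sup>* \<Longrightarrow> a \<in> W \<Longrightarrow> b \<notin> W \<Longrightarrow> \<exists>x y. (x, y) \<in> R \<and> x \<in> W \<and> y \<notin> W"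
  by (induction rule: rtrancl_induct) auto

lemma doubleton_in_edges: "{x, y} \<in> edges X \<longleftrightarrow> {x, y} \<in> X \<and> x \<noteq> y"
  by (auto simp: edges_def card_insert_if)

text \<open>The set of vertices reachable from \<open>u\<close> is a cut without crossing edge,
  which gives the backward direction. The cut form is easier to carry between complexes than paths
  are, since a path may use vertices or edges that the other complex lacks.\<close>

lemma complex_connected_iff_cut:
  "complex_connected X \<longleftrightarrow>
     (\<forall>W. \<forall>u\<in>\<Union>X. \<forall>v\<in>\<Union>X. u \<in> W \<longrightarrow> v \<notin> W \<longrightarrow> (\<exists>x\<in>W. \<exists>y. y \<notin> W \<and> {x, y} \<in> X))"
  (is "_ \<longleftrightarrow> ?cut")
proof
  assume c: "complex_connected X"
  show ?cut
  proof (intro allI ballI impI)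
    fix W u v assume "u \<in> \<Union>X" "v \<in> \<Union>X" "u \<in> W" "v \<notin> W"
    with c have "(u, v) \<in> {(x, y). {x, y} \<in> edges X}\<^sup>*"
      by (auto simp: complex_connected_def vertices_def)
    from rtrancl_exit[OF this \<open>u \<in> W\<close> \<open>v \<notin> W\<close>]
    show "\<exists>x\<in>W. \<exists>y. y \<notin> W \<and> {x, y} \<in> X"
      by (auto simp: edges_def)
  qed
next
  assume cut: ?cut
  show "complex_connected X"
    unfolding complex_connected_def vertices_def
  proof (intro ballI, rule ccontr)
    fix u v assume uv: "u \<in> \<Union>X" "v \<in> \<Union>X"
    let ?R = "{(x, y). {x, y} \<in> edges X}"
    assume "(u, v) \<notin> ?R\<^sup>*"
    then obtain x y where "(u, x) \<in> ?R\<^sup>*" "(u, y) \<notin> ?R\<^sup>*" "{x, y} \<in> X"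
      using cut[rule_format, of u v "{x. (u, x) \<in> ?R\<^sup>*}"] uv by auto
    moreover from this have "(x, y) \<in> ?R"
      by (auto simp: doubleton_in_edges)
    ultimately show False
      by (meson rtrancl.rtrancl_into_rtrancl)
  qed
qed

lemma complex_connected_cutD:
  assumes "complex_connected X" "u \<in> \<Union>X" "v \<in> \<Union>X" "u \<in> W" "v \<notin> W"
  obtains x y where "x \<in> W" "y \<notin> W" "{x, y} \<in> X"
  using assms complex_connected_iff_cut[of X] by blast

section \<open>Faces, purity and links of normal pseudomanifolds\<close>

lemma simplicial_complexD:
  assumes "simplicial_complex X"
  shows "finite X" and "\<sigma> \<in> X \<Longrightarrow> finite \<sigma>" and "\<sigma> \<in> X \<Longrightarrow> \<tau> \<subseteq> \<sigma> \<Longrightarrow> \<tau> \<in> X"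
  using assms by (auto simp: simplicial_complex_def)

lemma finite_vertices: "simplicial_complex X \<Longrightarrow> finite (\<Union>X)"
  by (auto simp: simplicial_complex_def)

lemma finite_edges: "simplicial_complex X \<Longrightarrow> finite (edges X)"
  by (auto simp: simplicial_complex_def edges_def)

lemma simplicial_extend_facet:
  assumes "simplicial_complex X" "\<alpha> \<in> X"
  shows "\<exists>\<phi>\<in>facets X. \<alpha> \<subseteq> \<phi>"
proof -
  have "finite {\<phi> \<in> X. \<alpha> \<subseteq> \<phi>}" "{\<phi> \<in> X. \<alpha> \<subseteq> \<phi>} \<noteq> {}"
    using assms by (auto simp: simplicial_complex_def)
  from finite_has_maximal[OF this] obtain m where
    m: "m \<in> X" "\<alpha> \<subseteq> m" "\<And>b. b \<in> X \<Longrightarrow> \<alpha> \<subseteq> b \<Longrightarrow> m \<subseteq> b \<Longrightarrow> m = b"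
    by auto
  then have "m \<in> facets X" by (auto simp: facets_def)
  with m show ?thesis by blast
qed

text \<open>Maximality of a face is awkward to follow through links and starrings; extendability to
  a face of d + 1 vertices is not.\<close>

lemma pure_dim_iff:
  "pure_dim d X \<longleftrightarrow> simplicial_complex X \<and> (\<exists>\<sigma>\<in>X. card \<sigma> = d + 1)
     \<and> (\<forall>\<alpha>\<in>X. card \<alpha> \<le> d + 1 \<and> (\<exists>\<phi>\<in>X. \<alpha> \<subseteq> \<phi> \<and> card \<phi> = d + 1))"
  (is "_ \<longleftrightarrow> ?r")
proof
  assume p: "pure_dim d X"
  then have s: "simplicial_complex X" by (simp add: pure_dim_def)
  have "card \<alpha> \<le> d + 1 \<and> (\<exists>\<phi>\<in>X. \<alpha> \<subseteq> \<phi> \<and> card \<phi> = d + 1)" if a: "\<alpha> \<in> X" for \<alpha>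
  proof -
    from simplicial_extend_facet[OF s a] obtain \<phi> where f: "\<phi> \<in> facets X" "\<alpha> \<subseteq> \<phi>" by blast
    then have "\<phi> \<in> X" "card \<phi> = d + 1"
      using p by (auto simp: pure_dim_def facets_def)
    moreover have "card \<alpha> \<le> card \<phi>"
      using f \<open>\<phi> \<in> X\<close> s by (auto intro: card_mono simplicial_complexD)
    ultimately show ?thesis using f by auto
  qed
  then show ?r using p by (auto simp: pure_dim_def)
next
  assume r: ?r
  have "card \<sigma> = d + 1" if "\<sigma> \<in> facets X" for \<sigma>
    using that r by (auto simp: facets_def)
  then show "pure_dim d X" using r by (auto simp: pure_dim_def)
qed

lemma pure_dim_facets:
  assumes "pure_dim d X"
  shows "facets X = {\<phi> \<in> X. card \<phi> = d + 1}"
proof -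
  have "\<tau> = \<sigma>" if "\<sigma> \<in> X" "card \<sigma> = d + 1" "\<tau> \<in> X" "\<sigma> \<subseteq> \<tau>" for \<sigma> \<tau>
  proof -
    have "finite \<tau>" "card \<tau> \<le> d + 1"
      using assms that by (auto simp: pure_dim_iff simplicial_complex_def)
    with that show ?thesis by (metis card_seteq)
  qed
  then show ?thesis using assms by (auto simp: facets_def pure_dim_def)
qed

lemma npm_D:
  assumes "normal_pseudomanifold d X"
  shows npm_pure: "pure_dim d X" and npm_simplicial: "simplicial_complex X"
    and npm_finite: "finite X" "\<And>\<alpha>. \<alpha> \<in> X \<Longrightarrow> finite \<alpha>"
    and npm_down: "\<And>\<alpha> \<beta>. \<alpha> \<in> X \<Longrightarrow> \<beta> \<subseteq> \<alpha> \<Longrightarrow> \<beta> \<in> X"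
    and npm_card_le: "\<And>\<alpha>. \<alpha> \<in> X \<Longrightarrow> card \<alpha> \<le> d + 1"
    and npm_extend: "\<And>\<alpha>. \<alpha> \<in> X \<Longrightarrow> \<exists>\<phi>\<in>X. \<alpha> \<subseteq> \<phi> \<and> card \<phi> = d + 1"
    and npm_ridge: "\<And>\<tau>. \<tau> \<in> X \<Longrightarrow> card \<tau> = d \<Longrightarrow> card {\<sigma> \<in> X. card \<sigma> = d + 1 \<and> \<tau> \<subseteq> \<sigma>} = 2"
    and npm_link: "\<And>\<alpha>. \<alpha> \<in> X \<Longrightarrow> card \<alpha> \<le> d - 1 \<Longrightarrow> complex_connected (link X \<alpha>)"
    and npm_ex_facet: "\<exists>\<sigma>\<in>X. card \<sigma> = d + 1"
    and npm_empty: "{} \<in> X"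
  using assms unfolding normal_pseudomanifold_def pure_dim_iff simplicial_complex_def
  by blast+

lemma npm_connected:
  assumes "normal_pseudomanifold d X" shows "complex_connected X"
proof -
  have "link X {} = X" by (auto simp: link_def)
  with npm_link[OF assms npm_empty[OF assms]] show ?thesis by simp
qed

lemma in_link_vertex: "simplicial_complex X \<Longrightarrow> \<beta> \<in> link X {v} \<longleftrightarrow> v \<notin> \<beta> \<and> insert v \<beta> \<in> X"
  by (auto simp: link_def simplicial_complex_def)

lemma link_link:
  "simplicial_complex X \<Longrightarrow> v \<notin> \<alpha> \<Longrightarrow> link (link X {v}) \<alpha> = link X (insert v \<alpha>)"
  unfolding link_def simplicial_complex_def
  by (auto; meson insert_mono subset_insertI sup_ge2 Un_upper2)

lemma simplicial_complex_link:
  assumes "simplicial_complex X" shows "simplicial_complex (link X \<alpha>)"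
  unfolding simplicial_complex_def
proof (intro conjI ballI allI impI)
  show "finite (link X \<alpha>)"
    using assms by (auto simp: link_def simplicial_complex_def)
  fix \<sigma> assume s: "\<sigma> \<in> link X \<alpha>"
  then show "finite \<sigma>" using assms by (auto simp: link_def simplicial_complex_def)
  fix \<tau> assume t: "\<tau> \<subseteq> \<sigma>"
  then have "\<alpha> \<union> \<tau> \<subseteq> \<alpha> \<union> \<sigma>" by blast
  with s t assms show "\<tau> \<in> link X \<alpha>"
    unfolding link_def simplicial_complex_def by blast
qed

text \<open>Inserting \<open>v\<close> is a bijection from the faces of the link to the faces of
  \<open>X\<close> through \<open>v\<close>. It raises sizes by one, and a link in the link is a
  link in \<open>X\<close>, so every clause descends by one dimension.\<close>

lemma npm_link_vertex:
  assumes X: "normal_pseudomanifold (Suc d) X" and d: "d \<ge> 1" and v: "v \<in> \<Union>X"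
  shows "normal_pseudomanifold d (link X {v})"
proof -
  note s = npm_simplicial[OF X]
  note lk = in_link_vertex[OF s]
  have fin: "finite \<alpha>" if "insert v \<alpha> \<in> X" for \<alpha>
    using npm_finite(2)[OF X that] by simp
  have vX: "{v} \<in> X" using v npm_down[OF X] by blast
  have ext: "\<exists>\<phi>\<in>link X {v}. \<alpha> \<subseteq> \<phi> \<and> card \<phi> = d + 1" if a: "\<alpha> \<in> link X {v}" for \<alpha>
  proof -
    from a obtain \<phi> where p: "\<phi> \<in> X" "insert v \<alpha> \<subseteq> \<phi>" "card \<phi> = Suc d + 1"
      using npm_extend[OF X] lk by blast
    then have "\<phi> - {v} \<in> link X {v}" "card (\<phi> - {v}) = d + 1"
      using npm_finite(2)[OF X] by (auto simp: lk insert_absorb)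
    with p a show ?thesis by (intro bexI[of _ "\<phi> - {v}"]) (auto simp: lk)
  qed
  have le: "card \<alpha> \<le> d + 1" if "\<alpha> \<in> link X {v}" for \<alpha>
    using npm_card_le[OF X, of "insert v \<alpha>"] that fin by (auto simp: lk)
  have "{} \<in> link X {v}" using vX by (simp add: lk)
  with ext le have "pure_dim d (link X {v})"
    unfolding pure_dim_iff using simplicial_complex_link[OF s] by blast
  moreover have "card {\<sigma> \<in> link X {v}. card \<sigma> = d + 1 \<and> \<tau> \<subseteq> \<sigma>} = 2"
    if t: "\<tau> \<in> link X {v}" "card \<tau> = d" for \<tau>
  proof -
    let ?S = "{\<sigma> \<in> link X {v}. card \<sigma> = d + 1 \<and> \<tau> \<subseteq> \<sigma>}"
    have "bij_betw (insert v) ?S {\<sigma> \<in> X. card \<sigma> = Suc d + 1 \<and> insert v \<tau> \<subseteq> \<sigma>}"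
    proof (rule bij_betw_byWitness[where f' = "\<lambda>\<sigma>. \<sigma> - {v}"])
      show "insert v ` ?S \<subseteq> {\<sigma> \<in> X. card \<sigma> = Suc d + 1 \<and> insert v \<tau> \<subseteq> \<sigma>}"
        using fin by (auto simp: lk)
      show "(\<lambda>\<sigma>. \<sigma> - {v}) ` {\<sigma> \<in> X. card \<sigma> = Suc d + 1 \<and> insert v \<tau> \<subseteq> \<sigma>} \<subseteq> ?S"
        using npm_finite(2)[OF X] t by (auto simp: lk insert_absorb)
    qed (auto simp: lk)
    moreover have "card {\<sigma> \<in> X. card \<sigma> = Suc d + 1 \<and> insert v \<tau> \<subseteq> \<sigma>} = 2"
      by (rule npm_ridge[OF X]) (use t fin in \<open>auto simp: lk\<close>)
    ultimately show ?thesis by (simp add: bij_betw_same_card)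
  qed
  moreover have "complex_connected (link (link X {v}) \<alpha>)"
    if a: "\<alpha> \<in> link X {v}" "card \<alpha> \<le> d - 1" for \<alpha>
  proof -
    \<comment> \<open>Subtraction is truncated: d \<ge> 1 is what makes (d - 1) + 1 equal to
      d.\<close>
    have "card (insert v \<alpha>) \<le> Suc d - 1"
      using a d fin by (auto simp: lk)
    then have "complex_connected (link X (insert v \<alpha>))"
      using npm_link[OF X] a by (auto simp: lk)
    then show ?thesis using link_link[OF s] a by (auto simp: lk)
  qed
  ultimately show ?thesis using d unfolding normal_pseudomanifold_def by blast
qed

section \<open>Strong connectedness: moving between facets across ridges\<close>

text \<open>\<open>F\<close> may contain arbitrary sets; only those that are d-faces of
  \<open>X\<close> matter. This freedom lets the preimage of \<open>F\<close> under
  \<open>insert x\<close> serve directly as a closed set for a link.\<close>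

definition ridge_closed :: "nat \<Rightarrow> 'a set set \<Rightarrow> 'a set set \<Rightarrow> bool" where
  "ridge_closed d X F \<longleftrightarrow> (\<forall>s\<in>F. \<forall>t\<in>X. s \<in> X \<longrightarrow> card s = d + 1 \<longrightarrow> card t = d + 1 \<longrightarrow>
      card (s \<inter> t) = d \<longrightarrow> t \<in> F)"

lemma ridge_closedD:
  "ridge_closed d X F \<Longrightarrow> s \<in> F \<Longrightarrow> s \<in> X \<Longrightarrow> t \<in> X \<Longrightarrow> card s = d + 1 \<Longrightarrow> card t = d + 1 \<Longrightarrow>
     card (s \<inter> t) = d \<Longrightarrow> t \<in> F"
  by (auto simp: ridge_closed_def)

lemma ridge_closed_link:
  assumes X: "simplicial_complex X"
    and cl: "\<And>s t. s \<in> F \<Longrightarrow> s \<in> X \<Longrightarrow> t \<in> X \<Longrightarrow> x \<in> s \<inter> t \<Longrightarrow> card s = Suc d + 1 \<Longrightarrow> card t = Suc d + 1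
      \<Longrightarrow> card (s \<inter> t) = Suc d \<Longrightarrow> t \<in> F"
  shows "ridge_closed d (link X {x}) {h. insert x h \<in> F}"
  unfolding ridge_closed_def
proof (intro ballI impI)
  fix s t assume st: "s \<in> {h. insert x h \<in> F}" "t \<in> link X {x}" "s \<in> link X {x}"
    "card s = d + 1" "card t = d + 1" "card (s \<inter> t) = d"
  then have "finite s" "finite t"
    by (metis Suc_eq_plus1 card.infinite nat.distinct(1))+
  then have "card (insert x (s \<inter> t)) = Suc d"
    using st by (auto simp: in_link_vertex[OF X])
  then have "card (insert x s \<inter> insert x t) = Suc d" by simp
  then have "insert x t \<in> F"
    using st \<open>finite s\<close> \<open>finite t\<close> by (intro cl[of "insert x s" "insert x t"]) (auto simp: in_link_vertex[OF X])
  then show "t \<in> {h. insert x h \<in> F}" by simp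
qed

text \<open>Induction on the dimension: facets with a common vertex are joined across ridges inside
  the link of that vertex, and connectedness of the edge graph carries membership in
  \<open>F\<close> from vertex to vertex.\<close>

lemma npm_strongly_connected:
  assumes "normal_pseudomanifold d X" "ridge_closed d X F"
    and "s \<in> F" "s \<in> X" "card s = d + 1" and "t \<in> X" "card t = d + 1"
  shows "t \<in> F"
  using assms
proof (induction d arbitrary: X F s t)
  case 0
  then show ?case by (simp add: normal_pseudomanifold_def)
next
  case (Suc d)
  note X = \<open>normal_pseudomanifold (Suc d) X\<close> and cl = ridge_closedD[OF \<open>ridge_closed (Suc d) X F\<close>]
  have sc: "simplicial_complex X" by (rule npm_simplicial[OF X])
  have local: "g \<in> F"
    if "f \<in> F" "f \<in> X" "card f = Suc d + 1" "g \<in> X" "card g = Suc d + 1" "x \<in> f \<inter> g" for f g x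
  \<comment> \<open>In dimension 1 the link is 0-dimensional, where the induction hypothesis is
    void; but two distinct edges with a common vertex already meet in a ridge.\<close>
  proof (cases "d = 0")
    case True
    show ?thesis
    proof (cases "f = g")
      case False
      have "finite f" "finite g" using that npm_finite[OF X] by auto
      moreover have "f \<inter> g \<noteq> f" using False that \<open>finite g\<close>
        by (metis card_subset_eq inf.absorb_iff1)
      ultimately have "card (f \<inter> g) < Suc (Suc 0)"
        using that True by (metis One_nat_def Int_lower1 Suc_eq_plus1 psubsetI psubset_card_mono)
      moreover have "card (f \<inter> g) \<noteq> 0" using \<open>finite f\<close> that by auto
      ultimately show ?thesis using that True by (intro cl[of f g]) auto
    qed (use that in simp)
  next
    case False
    have "normal_pseudomanifold d (link X {x})"
      using npm_link_vertex[OF X, of x] False that by auto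
    moreover have "ridge_closed d (link X {x}) {h. insert x h \<in> F}"
      by (rule ridge_closed_link[OF sc]) (use cl in auto)
    ultimately have "g - {x} \<in> {h. insert x h \<in> F}"
      by (rule Suc.IH[where s = "f - {x}"])
        (use that npm_finite[OF X] in \<open>auto simp: in_link_vertex[OF sc] insert_absorb\<close>)
    then show ?thesis using that by (simp add: insert_absorb)
  qed
  \<comment> \<open>The vertices covered by facets in \<open>F\<close>. A facet extending an edge
    that leaves this set shares a vertex with a facet in \<open>F\<close>, so it is in
    \<open>F\<close> by \<open>local\<close> and covers the outer end too.\<close>
  let ?W = "\<Union>{f \<in> F. f \<in> X \<and> card f = Suc d + 1}"
  show "t \<in> F"
  proof (rule ccontr)
    assume "t \<notin> F"
    from Suc.prems obtain a c where a: "a \<in> s" and c: "c \<in> t"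
      by (metis Suc_eq_plus1 card.empty equals0I nat.distinct(1))
    have "a \<in> ?W" using a Suc.prems by blast
    moreover have "c \<notin> ?W" using c local \<open>t \<notin> F\<close> Suc.prems by blast
    ultimately obtain x y where xy: "x \<in> ?W" "y \<notin> ?W" "{x, y} \<in> X"
      by (rule complex_connected_cutD[OF npm_connected[OF X], rotated 2]) (use a c Suc.prems in auto)
    then obtain g where "g \<in> X" "{x, y} \<subseteq> g" "card g = Suc d + 1"
      using npm_extend[OF X] by blast
    with xy local have "g \<in> F" by blast
    with xy \<open>g \<in> X\<close> \<open>{x, y} \<subseteq> g\<close> \<open>card g = Suc d + 1\<close> show False by blast
  qed
qed

text \<open>The ridge paths of the link stay in the star of \<open>x\<close>, so closure across
  ridges through \<open>x\<close> suffices. On surfaces this applies to triangle sets that are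
  closed only across edges meeting \<open>A\<close>.\<close>

lemma npm_star_strongly_connected:
  assumes X: "normal_pseudomanifold (Suc d) X" and "d \<ge> 1"
    and cl: "\<And>s t. s \<in> F \<Longrightarrow> s \<in> X \<Longrightarrow> t \<in> X \<Longrightarrow> x \<in> s \<inter> t \<Longrightarrow> card s = Suc d + 1 \<Longrightarrow> card t = Suc d + 1
      \<Longrightarrow> card (s \<inter> t) = Suc d \<Longrightarrow> t \<in> F"
    and "s \<in> F" "s \<in> X" "card s = Suc d + 1" "x \<in> s"
    and "t \<in> X" "card t = Suc d + 1" "x \<in> t"
  shows "t \<in> F"
proof -
  have sc: "simplicial_complex X" by (rule npm_simplicial[OF X])
  have "normal_pseudomanifold d (link X {x})"
    using npm_link_vertex[OF X, of x] assms by auto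
  moreover have "ridge_closed d (link X {x}) {h. insert x h \<in> F}"
    by (rule ridge_closed_link[OF sc]) (use cl in auto)
  ultimately have "t - {x} \<in> {h. insert x h \<in> F}"
    by (rule npm_strongly_connected[where s = "s - {x}"])
      (use assms(4-) npm_finite[OF X] in \<open>auto simp: in_link_vertex[OF sc] insert_absorb\<close>)
  then show ?thesis using assms by (simp add: insert_absorb)
qed

section \<open>Surfaces\<close>

lemma surface_star_connected:
  assumes "normal_pseudomanifold 2 X"
    and "\<And>s t. s \<in> F \<Longrightarrow> s \<in> X \<Longrightarrow> t \<in> X \<Longrightarrow> x \<in> s \<inter> t \<Longrightarrow> card s = 3 \<Longrightarrow> card t = 3
      \<Longrightarrow> card (s \<inter> t) = 2 \<Longrightarrow> t \<in> F"
    and "s \<in> F" "s \<in> X" "card s = 3" "x \<in> s" "t \<in> X" "card t = 3" "x \<in> t"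
  shows "t \<in> F"
proof -
  have eq: "Suc 1 = 2" "2 + 1 = (3::nat)" by simp_all
  show ?thesis
    by (rule npm_star_strongly_connected[of 1 X F x s t, unfolded eq]) (fact assms le_refl)+
qed

text \<open>A spanning forest count with everything outside \<open>A\<close> as the root. Remove
  \<open>x\<close> together with an edge from \<open>x\<close> to the outside: that edge has no end
  in A - {x}, so it never serves as a cut edge for a subset of A - {x}, and the hypothesis
  survives.\<close>

lemma card_le_card_cut_edges:
  assumes "finite R" "finite A"
    and "\<And>S. S \<subseteq> A \<Longrightarrow> S \<noteq> {} \<Longrightarrow> \<exists>e\<in>R. \<exists>x\<in>S. \<exists>y. y \<notin> S \<and> e = {x, y}"
  shows "card A \<le> card R"
  using assms(2,1,3)
proof (induction "card A" arbitrary: A R)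
  case 0
  then show ?case by simp
next
  case (Suc n)
  from Suc(2) have "A \<noteq> {}" by auto
  with Suc.prems(3) obtain x y where xy: "{x, y} \<in> R" "x \<in> A" "y \<notin> A" by blast
  have "card (A - {x}) \<le> card (R - {{x, y}})"
  proof (rule Suc.hyps(1))
    show "n = card (A - {x})" using Suc xy by simp
    fix S assume S: "S \<subseteq> A - {x}" "S \<noteq> {}"
    then obtain e a b where "e \<in> R" "a \<in> S" "b \<notin> S" "e = {a, b}"
      using Suc.prems(3)[of S] by blast
    moreover have "e \<noteq> {x, y}" using calculation S xy by auto
    ultimately show "\<exists>e\<in>R - {{x, y}}. \<exists>x\<in>S. \<exists>y. y \<notin> S \<and> e = {x, y}" by blast
  qed (use Suc in auto)
  then show ?case using xy Suc.prems(1,2)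
    by (metis Suc.prems(2) card_Suc_Diff1 Suc_le_mono)
qed

text \<open>A tree in the dual graph of a surface: \<open>K\<close> collects its triangles and \<open>P\<close> the
  edges of \<open>X\<close> across which consecutive triangles are glued.\<close>

inductive dual_tree :: "'a set set \<Rightarrow> 'a set \<Rightarrow> 'a set set \<Rightarrow> 'a set set \<Rightarrow> bool" for X A where
  root: "t \<in> X \<Longrightarrow> card t = 3 \<Longrightarrow> t \<inter> A \<noteq> {} \<Longrightarrow> dual_tree X A {t} {}"
| extend: "dual_tree X A K P \<Longrightarrow> s \<in> K \<Longrightarrow> t \<in> X \<Longrightarrow> card t = 3 \<Longrightarrow> t \<notin> K \<Longrightarrow>
     p \<subseteq> s \<inter> t \<Longrightarrow> card p = 2 \<Longrightarrow> p \<inter> A \<noteq> {} \<Longrightarrow> dual_tree X A (insert t K) (insert p P)"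

text \<open>Besides the tree identity, the essential clause is the last one: both triangles on an
  edge in \<open>P\<close> belong to \<open>K\<close>, so a triangle added later contains no earlier
  edge of \<open>P\<close>.\<close>

lemma dual_tree_invariants:
  assumes X: "normal_pseudomanifold 2 X" and "dual_tree X A K P"
  shows "finite K \<and> finite P \<and> K \<subseteq> {t \<in> X. card t = 3 \<and> t \<inter> A \<noteq> {}} \<and> card K = card P + 1
    \<and> P \<subseteq> {p \<in> edges X. p \<inter> A \<noteq> {} \<and> p \<subseteq> \<Union>K \<and> {t \<in> X. card t = 3 \<and> p \<subseteq> t} \<subseteq> K}"
  using assms(2)
proof induction
  case (root t)
  then show ?case by auto
next
  case (extend K P s t p)
  have sX: "s \<in> X" "card s = 3" using extend by auto
  have "p \<in> edges X" using extend npm_down[OF X, of t p] by (auto simp: edges_def)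
  moreover have "{t \<in> X. card t = 3 \<and> p \<subseteq> t} = {s, t}"
  proof -
    have "card {t \<in> X. card t = 3 \<and> p \<subseteq> t} = 2"
      using npm_ridge[OF X, of p] \<open>p \<in> edges X\<close> by (auto simp: edges_def)
    moreover have "{s, t} \<subseteq> {t \<in> X. card t = 3 \<and> p \<subseteq> t}" "s \<noteq> t"
      using extend sX by auto
    ultimately show ?thesis
      by (metis (no_types, lifting) card_2_iff card.infinite card_seteq order_refl zero_neq_numeral)
  qed
  moreover have "p \<notin> P" using extend by auto
  ultimately show ?case using extend by auto
qed

text \<open>The last triangle of the tree that carries an edge of \<open>Q\<close> carries only one.\<close>

lemma dual_tree_leaf:
  assumes X: "normal_pseudomanifold 2 X" and "dual_tree X A K P"
    and "Q \<subseteq> P" "Q \<noteq> {}"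
  shows "\<exists>t\<in>K. \<exists>q\<in>Q. q \<subseteq> t \<and> (\<forall>q'\<in>Q. q' \<subseteq> t \<longrightarrow> q' = q)"
  using assms(2-)
proof (induction arbitrary: Q)
  case (root t)
  then show ?case by auto
next
  case (extend K P s t p)
  show ?case
  proof (cases "p \<in> Q")
    case True
    \<comment> \<open>All triangles of \<open>X\<close> on an edge in \<open>P\<close> lie in
      \<open>K\<close>, while \<open>t\<close> does not.\<close>
    have *: "\<not> q \<subseteq> t" if "q \<in> P" for q
      using dual_tree_invariants[OF X extend.hyps(1)] that extend.hyps(3,4,5) by blast
    have "q' = p" if "q' \<in> Q" "q' \<subseteq> t" for q'
      using *[of q'] that extend.prems(1) by blast
    moreover have "p \<subseteq> t" using extend.hyps(6) by blast
    ultimately show ?thesis using True by blast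
  next
    case False
    then have "Q \<subseteq> P" using extend.prems by auto
    from extend.IH[OF this] extend.prems show ?thesis by blast
  qed
qed

text \<open>Take \<open>K\<close> of largest size: a triangle across an edge meeting
  \<open>A\<close> would otherwise extend the tree. The result is a spanning tree of one component
  of the dual graph on the open star of \<open>A\<close>.\<close>

lemma dual_tree_maximal:
  assumes X: "normal_pseudomanifold 2 X" and t: "t \<in> X" "card t = 3" "t \<inter> A \<noteq> {}"
  obtains K P where "dual_tree X A K P"
    and "\<And>s t p. s \<in> K \<Longrightarrow> t \<in> X \<Longrightarrow> card t = 3 \<Longrightarrow> p \<subseteq> s \<inter> t \<Longrightarrow> card p = 2 \<Longrightarrow> p \<inter> A \<noteq> {} \<Longrightarrow> t \<in> K"
proof -
  let ?Q = "\<lambda>n. \<exists>K P. dual_tree X A K P \<and> card K = n"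
  have "?Q 1" using dual_tree.root[OF t] by force
  moreover have "n \<le> card X" if "?Q n" for n
    using that dual_tree_invariants[OF X] npm_finite(1)[OF X] by (metis (no_types, lifting) card_mono
        mem_Collect_eq subset_eq)
  ultimately obtain n where n: "?Q n" "\<And>m. ?Q m \<Longrightarrow> m \<le> n"
    using Nat.ex_has_greatest_nat[of ?Q 1 "card X"] by blast
  then obtain K P where KP: "dual_tree X A K P" "card K = n" by blast
  have "t \<in> K" if "s \<in> K" "t \<in> X" "card t = 3" "p \<subseteq> s \<inter> t" "card p = 2" "p \<inter> A \<noteq> {}" for s t p
  proof (rule ccontr)
    assume "t \<notin> K"
    from dual_tree.extend[OF KP(1) that(1-3) this that(4-)] n(2)
    have "card (insert t K) \<le> n" by blast
    then show False using KP \<open>t \<notin> K\<close> dual_tree_invariants[OF X KP(1)] by simp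
  qed
  with KP that show ?thesis by blast
qed

section \<open>Boundary cycles and the edge count on a surface\<close>

lemma card_edges_in_face: "finite t \<Longrightarrow> card {e. e \<subseteq> t \<and> card e = 2} = card t choose 2"
  by (rule n_subsets)

lemma card_3_memE:
  assumes "card t = 3" "b \<in> t"
  obtains x y where "t = {b, x, y}" "b \<noteq> x" "b \<noteq> y" "x \<noteq> y"
proof -
  have "card (t - {b}) = 2" using assms by simp
  then obtain x y where xy: "t - {b} = {x, y}" "x \<noteq> y" by (auto simp: card_2_iff)
  then have "t = {b, x, y}" using assms(2) by blast
  moreover have "b \<noteq> x" "b \<noteq> y" using xy(1) by blast+
  ultimately show ?thesis using that xy(2) by blast
qed

lemma card_2_subset_triangle:
  assumes "card e = 2" "e \<subseteq> {a, b, c}"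
  shows "e = {a, b} \<or> e = {a, c} \<or> e = {b, c}"
proof -
  obtain x y where "e = {x, y}" "x \<noteq> y" using assms(1) by (auto simp: card_2_iff)
  with assms(2) show ?thesis by auto
qed

text \<open>The boundary of a set of triangles is a cycle modulo 2, and a nonempty cycle in a simple
  graph has at least three edges.\<close>

lemma boundary_card_ge_3:
  assumes X: "normal_pseudomanifold 2 X" and K: "K \<subseteq> {t \<in> X. card t = 3}"
    and ne: "K \<noteq> {}" and s: "\<sigma> \<in> X" "card \<sigma> = 3" "\<sigma> \<notin> K"
  defines "D \<equiv> {e \<in> edges X. card {t \<in> K. e \<subseteq> t} = 1}"
  shows "3 \<le> card D"
proof -
  have fX: "finite X" and fK: "finite K" using npm_finite(1)[OF X] K by (auto intro: finite_subset)
  have fE: "finite (edges X)" using finite_edges npm_simplicial[OF X] by blast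
  have le2: "card {t \<in> K. e \<subseteq> t} \<le> 2" if "e \<in> edges X" for e
  proof -
    have "card {t \<in> X. card t = 3 \<and> e \<subseteq> t} = 2"
      using npm_ridge[OF X, of e] that by (auto simp: edges_def)
    moreover have "{t \<in> K. e \<subseteq> t} \<subseteq> {t \<in> X. card t = 3 \<and> e \<subseteq> t}" using K by auto
    ultimately show ?thesis
      using fX card_mono[of "{t \<in> X. card t = 3 \<and> e \<subseteq> t}"] by simp
  qed
  \<comment> \<open>Count incidences of edges at \<open>b\<close> with triangles of \<open>K\<close>
    at \<open>b\<close>. Each triangle contributes two, so the total is even; an edge lies in at
    most two triangles, so an odd contribution is exactly 1, that is, a boundary edge.\<close>
  have even: "even (card {e \<in> D. b \<in> e})" for b
  proof -
    let ?E = "{e \<in> edges X. b \<in> e}" let ?K = "{t \<in> K. b \<in> t}"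
    have *: "card {e \<in> ?E. e \<subseteq> t} = 2" if "t \<in> ?K" for t
    proof -
      have "card t = 3" "b \<in> t" "t \<in> X" using that K by auto
      then obtain x y where t: "t = {b, x, y}" "b \<noteq> x" "b \<noteq> y" "x \<noteq> y"
        using card_3_memE[of t b] by metis
      have "{b, x} \<in> edges X" "{b, y} \<in> edges X"
        using npm_down[OF X \<open>t \<in> X\<close>] t by (auto simp: doubleton_in_edges)
      moreover have "e = {b, x} \<or> e = {b, y}" if "e \<in> ?E" "e \<subseteq> t" for e
        using card_2_subset_triangle[of e b x y] that t by (auto simp: edges_def)
      ultimately have "{e \<in> ?E. e \<subseteq> t} = {{b, x}, {b, y}}"
        using t(1) by auto
      then show ?thesis using t by (auto simp: doubleton_eq_iff)
    qed
    have "(\<Sum>e\<in>?E. card {t \<in> ?K. e \<subseteq> t}) = (\<Sum>t\<in>?K. 2)"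
      by (rule sum_multicount_gen) (use fE fK * in auto)
    moreover have "{t \<in> ?K. e \<subseteq> t} = {t \<in> K. e \<subseteq> t}" if "e \<in> ?E" for e using that by auto
    ultimately have "(\<Sum>e\<in>?E. card {t \<in> K. e \<subseteq> t}) = 2 * card ?K" by simp
    then have "even (\<Sum>e\<in>?E. card {t \<in> K. e \<subseteq> t})" by simp
    then have "even (card {e \<in> ?E. odd (card {t \<in> K. e \<subseteq> t})})"
      using fE by (simp add: even_sum_iff)
    moreover have "{e \<in> ?E. odd (card {t \<in> K. e \<subseteq> t})} = {e \<in> D. b \<in> e}"
    proof -
      have "odd (card {t \<in> K. e \<subseteq> t}) \<longleftrightarrow> card {t \<in> K. e \<subseteq> t} = 1" if "e \<in> edges X" for e
        using le2[OF that] by presburger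
      then show ?thesis by (auto simp: D_def)
    qed
    ultimately show ?thesis by simp
  qed
  have fD: "finite D" by (rule finite_subset[OF _ fE]) (simp add: D_def)
  have other: "\<exists>e'\<in>D. b \<in> e' \<and> e' \<noteq> e" if "e \<in> D" "b \<in> e" for e b
  proof (rule ccontr)
    assume "\<not> ?thesis"
    then have "{e \<in> D. b \<in> e} = {e}" using that by blast
    then show False using even[of b] by simp
  qed
  \<comment> \<open>Strong connectedness would put \<sigma> into \<open>K\<close>. Hence some edge
    separates a triangle in \<open>K\<close> from one outside, and it is the first boundary
    edge.\<close>
  have "\<not> ridge_closed 2 X K"
  proof
    assume cl: "ridge_closed 2 X K"
    from ne obtain s where "s \<in> K" by blast
    with K have "s \<in> X" "card s = 3" by auto
    with npm_strongly_connected[OF X cl \<open>s \<in> K\<close>] s show False by simp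
  qed
  then obtain s t where st: "s \<in> K" "t \<in> X" "t \<notin> K" "card s = 3" "card t = 3" "card (s \<inter> t) = 2" "s \<in> X"
    by (auto simp: ridge_closed_def)
  have "s \<inter> t \<in> edges X" using npm_down[OF X \<open>s \<in> X\<close>] st by (auto simp: edges_def)
  moreover have "card {k \<in> K. s \<inter> t \<subseteq> k} = 1"
  proof -
    have "card {k \<in> X. card k = 3 \<and> s \<inter> t \<subseteq> k} = 2"
      using npm_ridge[OF X, of "s \<inter> t"] \<open>s \<inter> t \<in> edges X\<close> by (auto simp: edges_def)
    moreover have "{k \<in> K. s \<inter> t \<subseteq> k} \<subset> {k \<in> X. card k = 3 \<and> s \<inter> t \<subseteq> k}" using K st by auto
    ultimately have "card {k \<in> K. s \<inter> t \<subseteq> k} < 2"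
      using fX psubset_card_mono[of "{k \<in> X. card k = 3 \<and> s \<inter> t \<subseteq> k}"] by simp
    moreover have "card {k \<in> K. s \<inter> t \<subseteq> k} \<noteq> 0" using st fK by auto
    ultimately show ?thesis by linarith
  qed
  ultimately have "s \<inter> t \<in> D" by (simp add: D_def)
  moreover obtain b c where bc: "s \<inter> t = {b, c}" "b \<noteq> c" using st by (auto simp: card_2_iff)
  ultimately have e: "{b, c} \<in> D" by simp
  \<comment> \<open>Even degree yields a further boundary edge at each end of the first one; the two
    differ, since an edge through both \<open>b\<close> and \<open>c\<close> is {b, c}.\<close>
  obtain e1 e2 where e1: "e1 \<in> D" "b \<in> e1" "e1 \<noteq> {b, c}" and e2: "e2 \<in> D" "c \<in> e2" "e2 \<noteq> {b, c}"
    using other[OF e, of b] other[OF e, of c] by auto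
  have "e1 \<noteq> e2"
  proof
    assume "e1 = e2"
    then have "{b, c} \<subseteq> e1" "card e1 = 2" using e1 e2 by (auto simp: D_def edges_def)
    then have "{b, c} = e1" using bc(2)
      by (intro card_subset_eq) (auto intro: card_ge_0_finite)
    with e1 show False by simp
  qed
  then have "card {{b, c}, e1, e2} = 3" using e1 e2 by auto
  moreover have "{{b, c}, e1, e2} \<subseteq> D" using e e1 e2 by auto
  ultimately show ?thesis using fD card_mono by metis
qed

text \<open>The edge bound of \<open>rigid\<close> without connectedness. Only this part is passed
  through cones and unions; connectedness of a normal pseudomanifold is immediate.\<close>

definition face_rigid :: "nat \<Rightarrow> nat \<Rightarrow> 'a set set \<Rightarrow> bool" where
  "face_rigid q d X \<longleftrightarrow> (\<forall>A. A \<subseteq> \<Union>X \<longrightarrow> (\<exists>\<sigma>\<in>X. card \<sigma> = d + 1 \<and> A \<inter> \<sigma> = {}) \<longrightarrow>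
     q * card A \<le> card {e \<in> edges X. e \<inter> A \<noteq> {}})"

lemma face_rigidD:
  "face_rigid q d X \<Longrightarrow> A \<subseteq> \<Union>X \<Longrightarrow> \<sigma> \<in> X \<Longrightarrow> card \<sigma> = d + 1 \<Longrightarrow> A \<inter> \<sigma> = {} \<Longrightarrow>
     q * card A \<le> card {e \<in> edges X. e \<inter> A \<noteq> {}}"
  by (auto simp: face_rigid_def)

lemma rigid_iff: "rigid q d X \<longleftrightarrow> complex_connected X \<and> face_rigid q d X"
  by (simp add: rigid_def face_rigid_def vertices_def)

text \<open>An Euler characteristic count on the open star of \<open>A\<close>, performed separately on each
  component of its dual graph.\<close>

lemma surface_edge_bound:
  assumes X: "normal_pseudomanifold 2 X" and s: "\<sigma> \<in> X" "card \<sigma> = 3"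
    and "A \<subseteq> \<Union>X" "A \<inter> \<sigma> = {}"
  shows "3 * card A \<le> card {e \<in> edges X. e \<inter> A \<noteq> {}}"
  using assms(4-)
proof (induction "card A" arbitrary: A rule: less_induct)
  case less
  show ?case
  proof (cases "A = {}")
    case False
    have fX: "finite X" using npm_finite(1)[OF X] .
    have fV: "finite (\<Union>X)" using finite_vertices npm_simplicial[OF X] by blast
    have fA: "finite A" using less.prems fV finite_subset by blast
    have fE: "finite (edges X)" using finite_edges npm_simplicial[OF X] by blast
    have extend: "\<exists>t\<in>X. card t = 3 \<and> \<alpha> \<subseteq> t" if "\<alpha> \<in> X" for \<alpha>
      using npm_extend[OF X that] by auto
    from False less.prems(1) obtain x \<alpha> where "x \<in> A" "x \<in> \<alpha>" "\<alpha> \<in> X" by blast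
    then obtain t0 where t0: "t0 \<in> X" "card t0 = 3" "t0 \<inter> A \<noteq> {}"
      using extend[of \<alpha>] by blast
    obtain K P where KP: "dual_tree X A K P"
      and closed: "\<And>s t p. s \<in> K \<Longrightarrow> t \<in> X \<Longrightarrow> card t = 3 \<Longrightarrow> p \<subseteq> s \<inter> t \<Longrightarrow> card p = 2 \<Longrightarrow> p \<inter> A \<noteq> {} \<Longrightarrow> t \<in> K"
      using dual_tree_maximal[OF X t0] by blast
    from dual_tree_invariants[OF X KP]
    have K: "finite K" "finite P" "K \<subseteq> {t \<in> X. card t = 3 \<and> t \<inter> A \<noteq> {}}" "card K = card P + 1"
      and P: "P \<subseteq> {p \<in> edges X. p \<inter> A \<noteq> {} \<and> p \<subseteq> \<Union>K \<and> {t \<in> X. card t = 3 \<and> p \<subseteq> t} \<subseteq> K}"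
      by auto
    \<comment> \<open>The vertices of \<open>A\<close> in the current dual component. By
      \<open>star\<close> below, every triangle at such a vertex is in \<open>K\<close>, so
      different components share no vertex of \<open>A\<close>.\<close>
    define B where "B = A \<inter> \<Union>K"
    have star: "t \<in> K" if "x \<in> B" "t \<in> X" "card t = 3" "x \<in> t" for x t
    proof -
      from that obtain s where "s \<in> K" "x \<in> s" by (auto simp: B_def)
      moreover have "t \<in> K" if "s \<in> K" "t \<in> X" "x \<in> s \<inter> t" "card t = 3" "card (s \<inter> t) = 2" for s t
        using closed[of s t "s \<inter> t"] that \<open>x \<in> B\<close> by (auto simp: B_def)
      ultimately show ?thesis
        using surface_star_connected[OF X, of K x s t] that K(3) by blast
    qed
    have edge_in: "e \<subseteq> \<Union>K" if "e \<in> edges X" "e \<inter> B \<noteq> {}" for e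
    proof -
      from that(1) have "e \<in> X" by (simp add: edges_def)
      with extend obtain t where "t \<in> X" "card t = 3" "e \<subseteq> t" by blast
      then show ?thesis using star that(2) by blast
    qed
    have BK: "t \<inter> B \<noteq> {}" if "t \<in> K" for t using that K by (auto simp: B_def)
    define E where "E = {e \<in> edges X. e \<inter> B \<noteq> {}}"
    have fEE: "finite E" using fE by (simp add: E_def)
    have "P \<subseteq> E" using P unfolding E_def B_def by blast

    have tree: "card B \<le> card (E - P)"
    proof (rule card_le_card_cut_edges)
      show "finite (E - P)" "finite B" using fEE fA by (auto simp: B_def)
      fix S assume S: "S \<subseteq> B" "S \<noteq> {}"
      show "\<exists>e\<in>E - P. \<exists>x\<in>S. \<exists>y. y \<notin> S \<and> e = {x, y}"
      proof (rule ccontr)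
        assume no: "\<not> ?thesis"
        \<comment> \<open>The cut of \<open>S\<close>. If no cut edge lies outside \<open>P\<close>,
          then the cut lies in the tree and some tree triangle contains exactly one cut edge; but a
          cut meets a triangle in none or two of its edges.\<close>
        define Q where "Q = {e \<in> edges X. \<exists>x\<in>S. \<exists>y. y \<notin> S \<and> e = {x, y}}"
        have QP: "Q \<subseteq> P"
        proof
          fix e assume "e \<in> Q"
          then have "e \<in> E" using S by (auto simp: Q_def E_def)
          with no \<open>e \<in> Q\<close> show "e \<in> P" by (auto simp: Q_def)
        qed
        \<comment> \<open>The vertices of \<sigma> lie outside \<open>A\<close>, hence outside
          \<open>S\<close>, so the cut separates two vertices of a connected complex.\<close>
        have "Q \<noteq> {}"
        proof -
          obtain u where u: "u \<in> S" using S by auto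
          obtain w where w: "w \<in> \<sigma>" using s by fastforce
          obtain x y where "x \<in> S" "y \<notin> S" "{x, y} \<in> X"
            by (rule complex_connected_cutD[OF npm_connected[OF X], of u w S])
              (use u w S s less.prems in \<open>auto simp: B_def\<close>)
          then have "{x, y} \<in> Q" by (auto simp: Q_def doubleton_in_edges)
          then show ?thesis by auto
        qed
        then have "\<exists>t\<in>K. \<exists>q\<in>Q. q \<subseteq> t \<and> (\<forall>q'\<in>Q. q' \<subseteq> t \<longrightarrow> q' = q)"
          by (rule dual_tree_leaf[OF X KP QP])
        then obtain t where "t \<in> K" and ex: "\<exists>q\<in>Q. q \<subseteq> t \<and> (\<forall>q'\<in>Q. q' \<subseteq> t \<longrightarrow> q' = q)"
          by blast
        from ex obtain q where q: "q \<in> Q" "q \<subseteq> t" and uq: "\<forall>q'\<in>Q. q' \<subseteq> t \<longrightarrow> q' = q"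
          by blast
        note tq = \<open>t \<in> K\<close> q
        from q(1) obtain a b where ab: "q = {a, b}" "a \<in> S" "b \<notin> S" by (auto simp: Q_def)
        have "t \<in> X" "card t = 3" using \<open>t \<in> K\<close> K(3) by auto
        moreover have "a \<in> t" using tq ab by blast
        ultimately obtain x y where "t = {a, x, y}" "a \<noteq> x" "a \<noteq> y" "x \<noteq> y"
          using card_3_memE[of t a] by metis
        moreover have "b \<in> t" "b \<noteq> a" using tq ab by blast+
        ultimately obtain c where c: "t = {a, b, c}" "a \<noteq> b" "b \<noteq> c" "a \<noteq> c"
          by (metis insert_commute insert_iff singletonD)
        have "{c, b} \<in> edges X" "{a, c} \<in> edges X"
          using npm_down[OF X \<open>t \<in> X\<close>] c by (auto simp: doubleton_in_edges)
        then have "{c, b} \<in> Q \<or> {a, c} \<in> Q"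
          using ab by (auto simp: Q_def)
        moreover have "{c, b} \<subseteq> t" "{a, c} \<subseteq> t" using c(1) by simp_all
        ultimately have "{c, b} = q \<or> {a, c} = q" using uq by meson
        then have "{c, b} = {a, b} \<or> {a, c} = {a, b}" unfolding ab(1) .
        then show False using c by (auto simp: doubleton_eq_iff)
      qed
    qed
    have "card E = card P + card (E - P)"
      using \<open>P \<subseteq> E\<close> fEE by (metis card_Diff_subset card_mono le_add_diff_inverse rev_finite_subset)
    \<comment> \<open>The edges of \<open>E\<close> outside \<open>P\<close> number at least card B,
      and \<open>P\<close> has one edge fewer than \<open>K\<close> has triangles.\<close>
    with tree K have euler: "card K + card B \<le> card E + 1" by linarith

    \<comment> \<open>The edges of \<open>t\<close> without a vertex in \<open>B\<close>. Counting
      incidences between \<open>E\<close> and \<open>K\<close> gives 2 card E plus the sum of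
      \<open>u\<close> equal to 3 card K, because each edge of \<open>E\<close> lies in two
      triangles of \<open>K\<close>.\<close>
    define u where "u t = card {e. e \<subseteq> t \<and> card e = 2 \<and> e \<inter> B = {}}" for t
    have count: "card {e \<in> E. e \<subseteq> t} + u t = 3" if "t \<in> K" for t
    proof -
      have t: "t \<in> X" "card t = 3" using that K by auto
      then have ft: "finite t" using npm_finite(2)[OF X] by auto
      have "{e \<in> E. e \<subseteq> t} \<union> {e. e \<subseteq> t \<and> card e = 2 \<and> e \<inter> B = {}} = {e. e \<subseteq> t \<and> card e = 2}"
        using npm_down[OF X t(1)] by (auto simp: E_def edges_def)
      moreover have "{e \<in> E. e \<subseteq> t} \<inter> {e. e \<subseteq> t \<and> card e = 2 \<and> e \<inter> B = {}} = {}"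
        by (auto simp: E_def)
      moreover have "finite {e. e \<subseteq> t \<and> card e = 2 \<and> e \<inter> B = {}}" using ft by auto
      ultimately have "card {e \<in> E. e \<subseteq> t} + u t = card {e. e \<subseteq> t \<and> card e = 2}"
        unfolding u_def using fEE by (subst card_Un_disjoint[symmetric]) auto
      also have "\<dots> = 3" using card_edges_in_face[OF ft] t by (simp add: choose_two)
      finally show ?thesis .
    qed
    have two: "card {t \<in> K. e \<subseteq> t} = 2" if "e \<in> E" for e
    proof -
      have "e \<inter> B \<noteq> {}" using that by (simp add: E_def)
      then obtain x where "x \<in> e" "x \<in> B" by blast
      then have "{t \<in> K. e \<subseteq> t} = {t \<in> X. card t = 3 \<and> e \<subseteq> t}"
        using K(3) star[of x] by blast
      then show ?thesis using npm_ridge[OF X, of e] that by (auto simp: E_def edges_def)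
    qed
    have "(\<Sum>t\<in>K. card {e \<in> E. e \<subseteq> t}) = (\<Sum>e\<in>E. 2)"
      by (rule sum_multicount_gen) (use fEE K two in auto)
    then have "2 * card E + (\<Sum>t\<in>K. u t) = (\<Sum>t\<in>K. card {e \<in> E. e \<subseteq> t} + u t)"
      by (simp add: sum.distrib)
    also have "\<dots> = 3 * card K" using count by simp
    finally have dc: "2 * card E + (\<Sum>t\<in>K. u t) = 3 * card K" .

    \<comment> \<open>Edges on exactly one triangle of \<open>K\<close>. They avoid
      \<open>B\<close>, since edges meeting \<open>B\<close> have both triangles in
      \<open>K\<close>; each is therefore counted by \<open>u\<close>, whose sum is at least
      3.\<close>
    let ?D = "{e \<in> edges X. card {t \<in> K. e \<subseteq> t} = 1}"
    let ?S = "SIGMA t:K. {e. e \<subseteq> t \<and> card e = 2 \<and> e \<inter> B = {}}"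
    have ft: "finite t" if "t \<in> K" for t using that K npm_finite(2)[OF X] by auto
    have "t0 \<inter> A \<noteq> {}" "K \<noteq> {}" using K t0 by auto
    then have "3 \<le> card ?D"
      by (intro boundary_card_ge_3[OF X _ _ s]) (use K less.prems in auto)
    also have "?D \<subseteq> snd ` ?S"
    proof
      fix e assume e: "e \<in> ?D"
      then obtain t where "t \<in> K" "e \<subseteq> t" by (fastforce simp: card_1_singleton_iff)
      moreover have "e \<inter> B = {}" using e two[of e] by (auto simp: E_def)
      moreover have "card e = 2" using e by (simp add: edges_def)
      ultimately show "e \<in> snd ` ?S" by (intro image_eqI[of _ _ "(t, e)"]) simp_all
    qed
    then have "card ?D \<le> card (snd ` ?S)" using K ft by (intro card_mono) auto
    also have "\<dots> \<le> card ?S" using K ft by (intro card_image_le) auto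
    also have "\<dots> = (\<Sum>t\<in>K. u t)" unfolding u_def using K ft by (intro card_SigmaI) auto
    \<comment> \<open>Three times \<open>euler\<close> minus \<open>dc\<close> gives 3 card B \<le>
      card E + 3 minus the sum of \<open>u\<close>; the boundary bound cancels the 3.\<close>
    finally have "3 * card B \<le> card E" using dc euler by linarith

    \<comment> \<open>The other components by induction. No edge is counted twice: an edge meeting
      \<open>B\<close> stays within the vertices of \<open>K\<close>, and the only vertices of
      \<open>A\<close> among those are in \<open>B\<close>.\<close>
    moreover have "3 * card (A - B) \<le> card {e \<in> edges X. e \<inter> (A - B) \<noteq> {}}"
    proof (rule less.hyps)
      have "A \<inter> B \<noteq> {}" using BK \<open>K \<noteq> {}\<close> unfolding B_def by blast
      then have "A - B \<subset> A" by auto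
      then show "card (A - B) < card A" using fA by (rule psubset_card_mono[rotated])
    qed (use less.prems in auto)
    moreover have "E \<inter> {e \<in> edges X. e \<inter> (A - B) \<noteq> {}} = {}"
    proof -
      have "e \<inter> (A - B) = {}" if "e \<in> E" for e
        using edge_in[of e] that by (auto simp: E_def B_def)
      then show ?thesis by blast
    qed
    then have "card E + card {e \<in> edges X. e \<inter> (A - B) \<noteq> {}}
        = card (E \<union> {e \<in> edges X. e \<inter> (A - B) \<noteq> {}})"
      using fE fEE by (intro card_Un_disjoint[symmetric]) auto
    moreover have "card (E \<union> {e \<in> edges X. e \<inter> (A - B) \<noteq> {}}) \<le> card {e \<in> edges X. e \<inter> A \<noteq> {}}"
      using fE by (intro card_mono) (auto simp: E_def B_def)
    moreover have "card A = card B + card (A - B)"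
      using card_Int_Diff[OF fA, of B] by (simp add: B_def Int_absorb1)
    ultimately show ?thesis by linarith
  qed simp
qed

lemma surface_face_rigid: "normal_pseudomanifold 2 X \<Longrightarrow> face_rigid 3 2 X"
  unfolding face_rigid_def using surface_edge_bound[of X] by auto

section \<open>Gluing vertex stars\<close>

text \<open>Split \<open>A\<close> by membership in the vertex set of \<open>X1\<close>. The inner
  part avoids \<sigma>; the outer part avoids \<rho>, because \<rho> is also a face of
  \<open>X1\<close>. The edges charged to the two parts are distinct, since no edge of
  \<open>X1\<close> has a vertex outside it.\<close>

lemma face_rigid_Un_aux:
  assumes X: "finite X1" "finite X2" "finite (\<Union>X1)"
    and r: "face_rigid q d X1" "face_rigid q d X2"
    and \<rho>: "\<rho> \<in> X1" "\<rho> \<in> X2" "card \<rho> = d + 1"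
    and \<sigma>: "\<sigma> \<in> X1" "card \<sigma> = d + 1" "A \<inter> \<sigma> = {}" and A: "A \<subseteq> \<Union>(X1 \<union> X2)" "finite A"
  shows "q * card A \<le> card {e \<in> edges (X1 \<union> X2). e \<inter> A \<noteq> {}}"
proof -
  let ?A1 = "A \<inter> \<Union>X1" and ?A2 = "A - \<Union>X1"
  let ?E1 = "{e \<in> edges X1. e \<inter> ?A1 \<noteq> {}}" and ?E2 = "{e \<in> edges X2. e \<inter> ?A2 \<noteq> {}}"
  have fin: "finite ?E1" "finite ?E2" "finite {e \<in> edges (X1 \<union> X2). e \<inter> A \<noteq> {}}"
    using X by (auto simp: edges_def)
  have "q * card ?A1 \<le> card ?E1"
    using \<sigma> by (intro face_rigidD[OF r(1) _ \<sigma>(1)]) auto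
  moreover have "q * card ?A2 \<le> card ?E2"
    using \<rho> A by (intro face_rigidD[OF r(2) _ \<rho>(2)]) auto
  moreover have "?E1 \<inter> ?E2 = {}" by (auto simp: edges_def)
  then have "card ?E1 + card ?E2 = card (?E1 \<union> ?E2)"
    using fin by (intro card_Un_disjoint[symmetric])
  moreover have "card (?E1 \<union> ?E2) \<le> card {e \<in> edges (X1 \<union> X2). e \<inter> A \<noteq> {}}"
    using fin by (intro card_mono) (auto simp: edges_def)
  moreover have "card A = card ?A1 + card ?A2"
    using A(2) by (rule card_Int_Diff)
  ultimately show ?thesis by (simp add: distrib_left)
qed

lemma face_rigid_Un:
  assumes "finite X1" "finite X2" "finite (\<Union>X1)" "finite (\<Union>X2)"
    and "face_rigid q d X1" "face_rigid q d X2"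
    and "\<rho> \<in> X1" "\<rho> \<in> X2" "card \<rho> = d + 1"
  shows "face_rigid q d (X1 \<union> X2)"
  unfolding face_rigid_def
proof (intro allI impI)
  fix A assume A: "A \<subseteq> \<Union>(X1 \<union> X2)" and ex: "\<exists>\<sigma>\<in>X1 \<union> X2. card \<sigma> = d + 1 \<and> A \<inter> \<sigma> = {}"
  have fA: "finite A" by (rule finite_subset[OF A]) (use assms in auto)
  from ex consider (1) \<sigma> where "\<sigma> \<in> X1" "card \<sigma> = d + 1" "A \<inter> \<sigma> = {}"
    | (2) \<sigma> where "\<sigma> \<in> X2" "card \<sigma> = d + 1" "A \<inter> \<sigma> = {}" by blast
  then show "q * card A \<le> card {e \<in> edges (X1 \<union> X2). e \<inter> A \<noteq> {}}"
  proof cases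
    case 1
    show ?thesis by (rule face_rigid_Un_aux[OF assms(1-3,5-9) 1 A fA])
  next
    case 2
    have "A \<subseteq> \<Union>(X2 \<union> X1)" using A by (simp add: Un_commute)
    from face_rigid_Un_aux[OF assms(2,1,4,6,5,8,7,9) 2 this fA]
    show ?thesis by (simp add: Un_commute)
  qed
qed

text \<open>The closed star; for a vertex \<open>v\<close> it is the cone with apex \<open>v\<close>
  over the link of \<open>v\<close>.\<close>

definition star :: "'a set set \<Rightarrow> 'a \<Rightarrow> 'a set set" where
  "star X v = {\<beta> \<in> X. insert v \<beta> \<in> X}"

lemma star_subset: "star X v \<subseteq> X"
  by (auto simp: star_def)

lemma star_down:
  "simplicial_complex X \<Longrightarrow> \<beta> \<in> star X v \<Longrightarrow> \<alpha> \<subseteq> \<beta> \<Longrightarrow> \<alpha> \<in> star X v"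
  unfolding star_def simplicial_complex_def by (metis (no_types, lifting) insert_mono mem_Collect_eq)

lemma in_vertices_star:
  assumes "simplicial_complex X"
  shows "x \<in> \<Union>(star X v) \<longleftrightarrow> {v, x} \<in> X"
proof
  assume "x \<in> \<Union>(star X v)"
  then obtain \<beta> where "x \<in> \<beta>" "insert v \<beta> \<in> X" by (auto simp: star_def)
  then show "{v, x} \<in> X" using simplicial_complexD(3)[OF assms, of "insert v \<beta>"] by simp
next
  assume vx: "{v, x} \<in> X"
  then have "{x} \<in> X" using simplicial_complexD(3)[OF assms vx] by simp
  with vx show "x \<in> \<Union>(star X v)" by (auto simp: star_def)
qed

lemma vertices_star:
  assumes "simplicial_complex X" "v \<in> \<Union>X"
  shows "\<Union>(star X v) = insert v (\<Union>(link X {v}))"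
proof -
  have "{v} \<in> X" using assms simplicial_complexD(3)[OF assms(1)] by blast
  have "x \<in> \<Union>(link X {v}) \<longleftrightarrow> {v, x} \<in> X \<and> x \<noteq> v" for x
  proof
    assume "x \<in> \<Union>(link X {v})"
    then obtain \<beta> where b: "x \<in> \<beta>" "insert v \<beta> \<in> X" "v \<notin> \<beta>"
      by (auto simp: in_link_vertex[OF assms(1)])
    then have "{v, x} \<in> X" using simplicial_complexD(3)[OF assms(1), of "insert v \<beta>"] by simp
    with b show "{v, x} \<in> X \<and> x \<noteq> v" by blast
  next
    assume "{v, x} \<in> X \<and> x \<noteq> v"
    then have "{x} \<in> link X {v}" by (auto simp: in_link_vertex[OF assms(1)])
    then show "x \<in> \<Union>(link X {v})" by blast
  qed
  then have "x \<in> insert v (\<Union>(link X {v})) \<longleftrightarrow> {v, x} \<in> X" for x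
    using \<open>{v} \<in> X\<close> by (cases "x = v") (simp_all del: Union_iff)
  then have "x \<in> \<Union>(star X v) \<longleftrightarrow> x \<in> insert v (\<Union>(link X {v}))" for x
    unfolding in_vertices_star[OF assms(1)] by blast
  then show ?thesis by (rule set_eqI)
qed

lemma notin_vertices_link: "v \<notin> \<Union>(link X {v})"
  by (auto simp: link_def)

lemma edges_star:
  assumes "simplicial_complex X" "v \<in> \<Union>X"
  shows "edges (star X v) = edges (link X {v}) \<union> (\<lambda>x. {v, x}) ` \<Union>(link X {v})" (is "?l = ?r")
proof
  show "?l \<subseteq> ?r"
  proof
    fix e assume e: "e \<in> ?l"
    then have es: "e \<in> star X v" "card e = 2" by (auto simp: edges_def)
    show "e \<in> ?r"
    proof (cases "v \<in> e")
      case True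
      then obtain x where x: "e = {v, x}" "x \<noteq> v" using es(2) by (auto simp: card_2_iff)
      then have "x \<in> \<Union>(star X v)" using es(1) by blast
      then have "x \<in> \<Union>(link X {v})" using vertices_star[OF assms] x by simp
      then show ?thesis using x by blast
    next
      case False
      then have "e \<in> link X {v}" using es by (auto simp: star_def in_link_vertex[OF assms(1)])
      then show ?thesis using es by (auto simp: edges_def)
    qed
  qed
  show "?r \<subseteq> ?l"
  proof
    fix e assume "e \<in> ?r"
    then show "e \<in> ?l"
    proof
      assume "e \<in> edges (link X {v})"
      then show ?thesis by (auto simp: edges_def star_def link_def)
    next
      assume "e \<in> (\<lambda>x. {v, x}) ` \<Union>(link X {v})"
      then obtain x where x: "e = {v, x}" "x \<in> \<Union>(link X {v})" by blast
      then have "x \<in> \<Union>(star X v)" "x \<noteq> v"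
        using vertices_star[OF assms] notin_vertices_link[of v X] by auto
      then have "{v, x} \<in> X" using in_vertices_star[OF assms(1)] by simp
      then show ?thesis using x \<open>x \<noteq> v\<close> by (simp add: edges_def star_def)
    qed
  qed
qed

text \<open>A d-face of the cone must contain the apex, for otherwise adding the apex would exceed
  the dimension. So \<open>A\<close> lies in the link, and each vertex of \<open>A\<close> gains the
  spoke to \<open>v\<close> on top of the edges from the link: this raises \<open>q\<close> by
  one.\<close>

lemma face_rigid_star:
  assumes X: "normal_pseudomanifold (Suc d) X" and v: "v \<in> \<Union>X"
    and r: "face_rigid q d (link X {v})"
  shows "face_rigid (Suc q) (Suc d) (star X v)"
  unfolding face_rigid_def
proof (intro allI impI)
  note sc = npm_simplicial[OF X]
  fix A assume A: "A \<subseteq> \<Union>(star X v)" and ex: "\<exists>\<sigma>\<in>star X v. card \<sigma> = Suc d + 1 \<and> A \<inter> \<sigma> = {}"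
  from ex obtain \<sigma> where "\<sigma> \<in> star X v" and \<sigma>': "card \<sigma> = Suc d + 1" "A \<inter> \<sigma> = {}"
    by blast
  then have \<sigma>: "\<sigma> \<in> X" "insert v \<sigma> \<in> X" "card \<sigma> = Suc d + 1" "A \<inter> \<sigma> = {}"
    by (simp_all add: star_def)
  have fs: "finite \<sigma>" using npm_finite(2)[OF X \<sigma>(1)] .
  have "v \<in> \<sigma>"
  proof (rule ccontr)
    assume "v \<notin> \<sigma>"
    then show False using npm_card_le[OF X \<sigma>(2)] \<sigma>(3) fs by simp
  qed
  then have AL: "A \<subseteq> \<Union>(link X {v})" using A \<sigma>(4) vertices_star[OF sc v] by auto
  have fL: "finite (edges (link X {v}))" "finite (\<Union>(link X {v}))"
    using simplicial_complex_link[OF sc] finite_edges finite_vertices by auto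
  have fA: "finite A" using AL fL finite_subset by blast
  let ?E = "{e \<in> edges (link X {v}). e \<inter> A \<noteq> {}}"
  have "\<sigma> - {v} \<in> link X {v}" using \<sigma>(1) \<open>v \<in> \<sigma>\<close> by (simp add: in_link_vertex[OF sc] insert_absorb)
  then have "q * card A \<le> card ?E"
    by (rule face_rigidD[OF r AL]) (use \<sigma> fs \<open>v \<in> \<sigma>\<close> in auto)
  moreover have "card ((\<lambda>x. {v, x}) ` A) = card A"
    by (rule card_image) (auto simp: inj_on_def doubleton_eq_iff)
  moreover have "?E \<inter> (\<lambda>x. {v, x}) ` A = {}"
    using notin_vertices_link[of v X] by (auto simp: edges_def)
  then have "card (?E \<union> (\<lambda>x. {v, x}) ` A) = card ?E + card ((\<lambda>x. {v, x}) ` A)"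
    using fL fA by (intro card_Un_disjoint) auto
  moreover have "card (?E \<union> (\<lambda>x. {v, x}) ` A) \<le> card {e \<in> edges (star X v). e \<inter> A \<noteq> {}}"
    by (rule card_mono) (use fL AL in \<open>auto simp: edges_star[OF sc v]\<close>)
  ultimately show "Suc q * card A \<le> card {e \<in> edges (star X v). e \<inter> A \<noteq> {}}" by simp
qed

text \<open>Finite connected vertex sets, presented by an order of construction so that stars can be
  glued by rule induction.\<close>

inductive grown :: "('a \<Rightarrow> 'a \<Rightarrow> bool) \<Rightarrow> 'a set \<Rightarrow> bool" for E where
  single: "grown E {w}"
| grow: "grown E W \<Longrightarrow> w \<in> W \<Longrightarrow> E w x \<Longrightarrow> grown E (insert x W)"

lemma grown_finite_nonempty: "grown E W \<Longrightarrow> finite W \<and> W \<noteq> {}"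
  by (induction rule: grown.induct) auto

abbreviation adj :: "'a set set \<Rightarrow> 'a \<Rightarrow> 'a \<Rightarrow> bool" where
  "adj X x y \<equiv> {x, y} \<in> edges X"

lemma grown_vertices:
  assumes X: "simplicial_complex X" "complex_connected X" and v: "v \<in> \<Union>X"
  shows "grown (adj X) (\<Union>X)"
proof -
  let ?Q = "\<lambda>n. \<exists>W. grown (adj X) W \<and> W \<subseteq> \<Union>X \<and> card W = n"
  have "?Q 1" using grown.single[of "adj X" v] v by (intro exI[of _ "{v}"]) simp
  moreover have "n \<le> card (\<Union>X)" if "?Q n" for n
    using that finite_vertices[OF X(1)] card_mono by blast
  ultimately obtain n where n: "?Q n" "\<And>m. ?Q m \<Longrightarrow> m \<le> n"
    using Nat.ex_has_greatest_nat[of ?Q 1 "card (\<Union>X)"] by blast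
  then obtain W where W: "grown (adj X) W" "W \<subseteq> \<Union>X" "card W = n" by blast
  have "W = \<Union>X"
  proof (rule ccontr)
    assume "W \<noteq> \<Union>X"
    then obtain u where u: "u \<in> \<Union>X" "u \<notin> W" using W(2) by blast
    obtain w where w: "w \<in> W" using grown_finite_nonempty[OF W(1)] by blast
    obtain x y where xy: "x \<in> W" "y \<notin> W" "{x, y} \<in> X"
      by (rule complex_connected_cutD[OF X(2) _ u(1) w u(2)]) (use w W(2) in blast)+
    then have "{x, y} \<in> edges X" by (auto simp: doubleton_in_edges)
    from grown.grow[of "adj X", OF W(1) xy(1) this] have "grown (adj X) (insert y W)" .
    moreover have "insert y W \<subseteq> \<Union>X" using xy W(2) by blast
    ultimately have "card (insert y W) \<le> n" using n(2) by blast
    then show False using W(3) xy(2) grown_finite_nonempty[OF W(1)] by simp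
  qed
  with W show ?thesis by simp
qed

lemma Union_star_vertices:
  assumes "simplicial_complex X" "v \<in> \<Union>X"
  shows "(\<Union>w\<in>\<Union>X. star X w) = X"
proof
  show "X \<subseteq> (\<Union>w\<in>\<Union>X. star X w)"
  proof
    fix \<beta> assume b: "\<beta> \<in> X"
    show "\<beta> \<in> (\<Union>w\<in>\<Union>X. star X w)"
    proof (cases "\<beta> = {}")
      case True
      then have "\<beta> \<in> star X v"
        using b assms simplicial_complexD(3)[OF assms(1)] unfolding star_def by blast
      with assms(2) show ?thesis by blast
    next
      case False
      then obtain w where "w \<in> \<beta>" by blast
      then have "\<beta> \<in> star X w" using b by (simp add: star_def insert_absorb)
      then show ?thesis using \<open>w \<in> \<beta>\<close> b by blast
    qed
  qed
qed (auto simp: star_def)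

lemma star_facet:
  assumes X: "normal_pseudomanifold d X" and "{v, w} \<in> X"
  obtains \<rho> where "\<rho> \<in> star X v" "\<rho> \<in> star X w" "card \<rho> = d + 1"
proof -
  obtain \<rho> where "\<rho> \<in> X" "{v, w} \<subseteq> \<rho>" "card \<rho> = d + 1"
    using npm_extend[OF X assms(2)] by blast
  then show ?thesis using that[of \<rho>] by (simp add: star_def insert_absorb)
qed

text \<open>A facet through the edge from the old vertex \<open>w\<close> to the new vertex
  \<open>x\<close> lies in both stars, as gluing requires. Arbitrary connected \<open>W\<close> are
  allowed, since chordality will come from unions over proper subsets of the vertices.\<close>

lemma face_rigid_stars:
  assumes X: "normal_pseudomanifold d X"
    and st: "\<And>v. v \<in> \<Union>X \<Longrightarrow> face_rigid q d (star X v)"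
    and W: "grown (adj X) W"
  shows "W \<subseteq> \<Union>X \<Longrightarrow> face_rigid q d (\<Union>w\<in>W. star X w)"
  using W
proof induction
  case (single w)
  then show ?case using st by simp
next
  case (grow W w x)
  note fX = npm_finite(1)[OF X] and fV = finite_vertices[OF npm_simplicial[OF X]]
  have "(\<Union>w\<in>W. star X w) \<subseteq> X" by (auto simp: star_def)
  then have fin: "finite (\<Union>w\<in>W. star X w)" "finite (\<Union>(\<Union>w\<in>W. star X w))"
    using fX fV by (meson Union_mono finite_subset)+
  have fin': "finite (star X x)" "finite (\<Union>(star X x))"
    using fX fV star_subset[of X x] by (meson Union_mono finite_subset)+
  from grow have "{w, x} \<in> X" by (simp add: edges_def)
  then obtain \<rho> where \<rho>: "\<rho> \<in> star X w" "\<rho> \<in> star X x" "card \<rho> = d + 1"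
    by (rule star_facet[OF X])
  have "face_rigid q d ((\<Union>w\<in>W. star X w) \<union> star X x)"
    by (rule face_rigid_Un[where \<rho> = \<rho>]) (use fin fin' grow st \<rho> in auto)
  then show ?case by (simp add: Un_commute)
qed

theorem npm_face_rigid:
  assumes "2 \<le> d" "normal_pseudomanifold d X"
  shows "face_rigid (d + 1) d X"
  using assms
proof (induction d arbitrary: X rule: dec_induct)
  case base
  then show ?case using surface_face_rigid by (simp add: numeral_3_eq_3)
next
  case (step d)
  note X = \<open>normal_pseudomanifold (Suc d) X\<close> and sc = npm_simplicial[OF \<open>normal_pseudomanifold (Suc d) X\<close>]
  have st: "face_rigid (Suc (d + 1)) (Suc d) (star X v)" if v: "v \<in> \<Union>X" for v
    using step.hyps v by (intro face_rigid_star[OF X v] step.IH npm_link_vertex[OF X]) auto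
  obtain \<sigma> where "\<sigma> \<in> X" "card \<sigma> = Suc d + 1" using npm_ex_facet[OF X] by blast
  then have "\<sigma> \<noteq> {}" by auto
  with \<open>\<sigma> \<in> X\<close> obtain v where v: "v \<in> \<Union>X" by blast
  have "face_rigid (Suc (d + 1)) (Suc d) (\<Union>w\<in>\<Union>X. star X w)"
    by (rule face_rigid_stars[OF X st grown_vertices[OF sc npm_connected[OF X] v]]) simp_all
  then show ?case using Union_star_vertices[OF sc v] by simp
qed

lemma npm_rigid: "2 \<le> d \<Longrightarrow> normal_pseudomanifold d X \<Longrightarrow> rigid (d + 1) d X"
  by (simp only: rigid_iff npm_connected npm_face_rigid simp_thms)

section \<open>Starring a vertex in a facet\<close>

text \<open>The result of \<open>star_in\<close> described by all of its faces instead of generating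
  facets: \<sigma> is traded for the cone over its boundary. Membership then depends only on whether
  \<open>v\<close> is in the face.\<close>

definition star_face :: "'a set set \<Rightarrow> 'a set \<Rightarrow> 'a \<Rightarrow> 'a set set" where
  "star_face X \<sigma> v = (X - {\<sigma>}) \<union> insert v ` {\<tau>. \<tau> \<subset> \<sigma>}"

lemma in_link_iff:
  "simplicial_complex X \<Longrightarrow> \<beta> \<in> link X \<alpha> \<longleftrightarrow> \<beta> \<inter> \<alpha> = {} \<and> \<alpha> \<union> \<beta> \<in> X"
  unfolding link_def simplicial_complex_def by blast

lemma in_vertices_simplicial: "simplicial_complex X \<Longrightarrow> x \<in> \<Union>X \<longleftrightarrow> {x} \<in> X"
  unfolding simplicial_complex_def by blast

lemma card_2_eq_cases:
  assumes "finite A" "B \<subseteq> A" "card A = card B + 2"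
  obtains x y where "A - B = {x, y}" "x \<noteq> y"
proof -
  have "card (A - B) = 2"
    using assms by (simp add: card_Diff_subset finite_subset)
  then show ?thesis using that by (auto simp: card_2_iff)
qed

lemma card_Suc_superset:
  assumes "finite B" "A \<subseteq> B" "card B = Suc (card A)"
  obtains z where "z \<notin> A" "B = insert z A"
proof -
  have "card (B - A) = 1"
    using assms by (simp add: card_Diff_subset finite_subset)
  then obtain z where "B - A = {z}" by (auto simp: card_1_singleton_iff)
  then show ?thesis using assms(2) that[of z] by blast
qed

lemma psubset_if_card_less: "\<tau> \<subseteq> \<sigma> \<Longrightarrow> card \<tau> < card \<sigma> \<Longrightarrow> \<tau> \<subset> \<sigma>"
  by auto

lemma card_union_doubleton_le: "card (\<alpha> \<union> {x, y}) \<le> card \<alpha> + 2"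
  using card_Un_le[of \<alpha> "{x, y}"] card_insert_le_m1[of 2 "{y}" x] by fastforce

text \<open>\<open>X\<close> is only a complex of bounded dimension, not a pseudomanifold, so that
  properties of the starred complex can also be transferred back to \<open>X\<close>.\<close>

context
  fixes X :: "'a set set" and \<sigma> :: "'a set" and v :: 'a and d :: nat
  assumes d: "1 \<le> d" and X: "simplicial_complex X" and \<sigma>: "\<sigma> \<in> X" "card \<sigma> = d + 1"
    and v: "v \<notin> \<Union>X" and dim: "\<And>\<alpha>. \<alpha> \<in> X \<Longrightarrow> card \<alpha> \<le> d + 1"
begin

private lemma fin: "\<alpha> \<in> X \<Longrightarrow> finite \<alpha>" and down: "\<alpha> \<in> X \<Longrightarrow> \<beta> \<subseteq> \<alpha> \<Longrightarrow> \<beta> \<in> X"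
  using X by (auto simp: simplicial_complex_def)

private lemma fin_\<sigma>: "finite \<sigma>"
  using fin \<sigma> by blast

private lemma v_notin: "\<alpha> \<in> X \<Longrightarrow> v \<notin> \<alpha>"
  using v by blast

private lemma v_notin_\<sigma>: "v \<notin> \<sigma>"
  using v_notin \<sigma> by blast

private lemma max_\<sigma>: "\<alpha> \<in> X \<Longrightarrow> \<sigma> \<subseteq> \<alpha> \<Longrightarrow> \<alpha> = \<sigma>"
  using card_seteq[of \<alpha> \<sigma>] fin dim \<sigma> by auto

lemma in_star_face_new: "v \<in> \<beta> \<Longrightarrow> \<beta> \<in> star_face X \<sigma> v \<longleftrightarrow> \<beta> - {v} \<subset> \<sigma>"
proof
  assume "v \<in> \<beta>" "\<beta> \<in> star_face X \<sigma> v"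
  then obtain \<tau> where "\<beta> = insert v \<tau>" "\<tau> \<subset> \<sigma>" using v_notin by (auto simp: star_face_def)
  then show "\<beta> - {v} \<subset> \<sigma>" using v_notin_\<sigma> by auto
next
  assume "v \<in> \<beta>" "\<beta> - {v} \<subset> \<sigma>"
  then show "\<beta> \<in> star_face X \<sigma> v"
    unfolding star_face_def by (intro UnI2 image_eqI[of _ _ "\<beta> - {v}"]) auto
qed

lemma in_star_face_old: "v \<notin> \<beta> \<Longrightarrow> \<beta> \<in> star_face X \<sigma> v \<longleftrightarrow> \<beta> \<in> X \<and> \<beta> \<noteq> \<sigma>"
  by (auto simp: star_face_def)

lemma simplicial_complex_star_face: "simplicial_complex (star_face X \<sigma> v)"
proof -
  have "finite (star_face X \<sigma> v)"
    using X fin_\<sigma> finite_subset[of "{\<tau>. \<tau> \<subset> \<sigma>}" "Pow \<sigma>"]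
    by (auto simp: star_face_def simplicial_complex_def)
  moreover have "finite \<beta>" if "\<beta> \<in> star_face X \<sigma> v" for \<beta>
    using that fin fin_\<sigma> by (auto simp: star_face_def finite_subset)
  moreover have "\<gamma> \<in> star_face X \<sigma> v" if b: "\<beta> \<in> star_face X \<sigma> v" and g: "\<gamma> \<subseteq> \<beta>" for \<beta> \<gamma>
  proof (cases "v \<in> \<gamma>")
    case True
    then have "v \<in> \<beta>" using g by blast
    then have "\<beta> - {v} \<subset> \<sigma>" using b in_star_face_new by blast
    then show ?thesis using g in_star_face_new[OF True] by blast
  next
    case False
    show ?thesis
    proof (cases "v \<in> \<beta>")
      case True
      then have "\<gamma> \<subset> \<sigma>" using b g False in_star_face_new[OF True] by blast
      then show ?thesis using in_star_face_old[OF False] down[OF \<sigma>(1)] by blast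
    next
      case v\<beta>: False
      then have "\<beta> \<in> X" "\<beta> \<noteq> \<sigma>" using b in_star_face_old by blast+
      then show ?thesis using in_star_face_old[OF False] down[of \<beta> \<gamma>] g max_\<sigma>[of \<beta>] by blast
    qed
  qed
  ultimately show ?thesis by (auto simp: simplicial_complex_def)
qed

private lemma new_facet:
  assumes "a \<in> \<sigma>"
  shows "insert v (\<sigma> - {a}) \<in> star_face X \<sigma> v" "card (insert v (\<sigma> - {a})) = d + 1"
proof -
  show "insert v (\<sigma> - {a}) \<in> star_face X \<sigma> v"
    using in_star_face_new[of "insert v (\<sigma> - {a})"] assms by auto
  show "card (insert v (\<sigma> - {a})) = d + 1"
    using assms v_notin_\<sigma> fin_\<sigma> \<sigma>(2) by simp
qed

lemma pure_dim_star_face_iff: "pure_dim d (star_face X \<sigma> v) \<longleftrightarrow> pure_dim d X"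
proof -
  have ext1: "\<exists>\<phi>\<in>star_face X \<sigma> v. \<alpha> \<subseteq> \<phi> \<and> card \<phi> = d + 1" if "\<alpha> - {v} \<subset> \<sigma>" for \<alpha>
  proof -
    from that obtain a where "a \<in> \<sigma>" "a \<notin> \<alpha> - {v}" by blast
    then show ?thesis
      using that new_facet[of a] by (intro bexI[of _ "insert v (\<sigma> - {a})"]) auto
  qed
  have le: "card \<alpha> \<le> d + 1" if "\<alpha> \<in> star_face X \<sigma> v" for \<alpha>
  proof (cases "v \<in> \<alpha>")
    case True
    then have "\<alpha> - {v} \<subset> \<sigma>" using that in_star_face_new by blast
    then have "card (\<alpha> - {v}) < d + 1" using psubset_card_mono[OF fin_\<sigma>] \<sigma>(2) by metis
    then show ?thesis using True
      by (metis Suc_eq_plus1 Suc_leI card.infinite card.insert_remove finite_Diff insert_absorb le0)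
  next
    case False
    then show ?thesis using that in_star_face_old dim by blast
  qed
  have "\<sigma> \<noteq> {}" using \<sigma>(2) by auto
  then obtain a where "a \<in> \<sigma>" by blast
  then have ex: "\<exists>\<sigma>'\<in>star_face X \<sigma> v. card \<sigma>' = d + 1"
    using new_facet by blast
  have "(\<forall>\<alpha>\<in>star_face X \<sigma> v. \<exists>\<phi>\<in>star_face X \<sigma> v. \<alpha> \<subseteq> \<phi> \<and> card \<phi> = d + 1)
      \<longleftrightarrow> (\<forall>\<alpha>\<in>X. \<exists>\<phi>\<in>X. \<alpha> \<subseteq> \<phi> \<and> card \<phi> = d + 1)" (is "?l \<longleftrightarrow> ?r")
  proof
    assume l: ?l
    show ?r
    proof
      fix \<alpha> assume a: "\<alpha> \<in> X"
      show "\<exists>\<phi>\<in>X. \<alpha> \<subseteq> \<phi> \<and> card \<phi> = d + 1"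
      proof (cases "\<alpha> = \<sigma>")
        case False
        then obtain \<phi> where p: "\<phi> \<in> star_face X \<sigma> v" "\<alpha> \<subseteq> \<phi>" "card \<phi> = d + 1"
          using l in_star_face_old[OF v_notin[OF a]] a by blast
        show ?thesis
        proof (cases "v \<in> \<phi>")
          case True
          then have "\<alpha> \<subseteq> \<sigma>" using p in_star_face_new[OF True] v_notin[OF a] by blast
          then show ?thesis using \<sigma> by blast
        next
          case False
          then show ?thesis using p in_star_face_old[OF False] by blast
        qed
      qed (use \<sigma> in blast)
    qed
  next
    assume r: ?r
    show ?l
    proof
      fix \<alpha> assume a: "\<alpha> \<in> star_face X \<sigma> v"
      show "\<exists>\<phi>\<in>star_face X \<sigma> v. \<alpha> \<subseteq> \<phi> \<and> card \<phi> = d + 1"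
      proof (cases "\<alpha> - {v} \<subset> \<sigma>")
        case False
        then have "v \<notin> \<alpha>" using a in_star_face_new by blast
        then have "\<alpha> \<in> X" "\<alpha> \<noteq> \<sigma>" using a in_star_face_old by blast+
        with r obtain \<phi> where p: "\<phi> \<in> X" "\<alpha> \<subseteq> \<phi>" "card \<phi> = d + 1" by blast
        moreover have "\<phi> \<noteq> \<sigma>" using p \<open>v \<notin> \<alpha>\<close> \<open>\<alpha> \<noteq> \<sigma>\<close> False by blast
        ultimately show ?thesis using in_star_face_old[OF v_notin[of \<phi>]] by blast
      qed (rule ext1)
    qed
  qed
  then show ?thesis
    unfolding pure_dim_iff using X \<sigma> dim le ex simplicial_complex_star_face by blast
qed

text \<open>For a ridge inside \<sigma> the facet \<sigma> is exchanged for
  \<open>insert v \<tau>\<close>; for any other ridge the facets are unchanged.\<close>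

private lemma old_ridge:
  assumes \<tau>: "\<tau> \<in> X" "card \<tau> = d"
  shows "card {\<phi> \<in> star_face X \<sigma> v. card \<phi> = d + 1 \<and> \<tau> \<subseteq> \<phi>} = card {\<phi> \<in> X. card \<phi> = d + 1 \<and> \<tau> \<subseteq> \<phi>}"
    (is "card ?F' = card ?F")
proof (cases "\<tau> \<subseteq> \<sigma>")
  case False
  have "\<phi> \<in> star_face X \<sigma> v \<longleftrightarrow> \<phi> \<in> X" if "\<tau> \<subseteq> \<phi>" for \<phi>
  proof (cases "v \<in> \<phi>")
    case True
    then show ?thesis
      using in_star_face_new[OF True] v_notin[of \<phi>] v_notin[OF \<tau>(1)] that False by blast
  next
    case v\<phi>: False
    then show ?thesis using in_star_face_old[OF v\<phi>] that False by blast
  qed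
  then have "?F' = ?F" by blast
  then show ?thesis by simp
next
  case True
  have "\<tau> \<subset> \<sigma>" using True \<tau> \<sigma> by auto
  have v\<tau>: "v \<notin> \<tau>" using v_notin[OF \<tau>(1)] .
  have f\<tau>: "finite \<tau>" using fin[OF \<tau>(1)] .
  have fF: "finite ?F" using X by (simp add: simplicial_complex_def)
  have "\<phi> \<in> ?F' \<longleftrightarrow> \<phi> \<in> insert (insert v \<tau>) (?F - {\<sigma>})" for \<phi>
  proof (cases "v \<in> \<phi>")
    case True
    have "\<phi> = insert v \<tau>" if p: "\<phi> \<in> star_face X \<sigma> v" "card \<phi> = d + 1" "\<tau> \<subseteq> \<phi>"
    proof -
      have "\<phi> - {v} \<subset> \<sigma>" using p in_star_face_new[OF True] by blast
      then have fp: "finite (\<phi> - {v})" using fin_\<sigma> finite_subset by blast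
      have "card (\<phi> - {v}) = card \<tau>" using p True \<tau> by simp
      then have "\<tau> = \<phi> - {v}" using p(3) v\<tau> fp by (intro card_subset_eq) auto
      then show ?thesis using True by blast
    qed
    moreover have "insert v \<tau> \<in> ?F'"
      using in_star_face_new[of "insert v \<tau>"] \<open>\<tau> \<subset> \<sigma>\<close> v\<tau> f\<tau> \<tau>(2) by auto
    ultimately show ?thesis using True v_notin[of \<phi>] by auto
  next
    case False
    then show ?thesis using in_star_face_old[OF False] by auto
  qed
  then have "?F' = insert (insert v \<tau>) (?F - {\<sigma>})" by (rule set_eqI)
  moreover have "insert v \<tau> \<notin> X" using v_notin by blast
  then have "card (insert (insert v \<tau>) (?F - {\<sigma>})) = Suc (card (?F - {\<sigma>}))"
    using fF by (intro card_insert_disjoint) auto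
  moreover have "Suc (card (?F - {\<sigma>})) = card ?F"
    using card_Suc_Diff1[OF fF, of \<sigma>] \<sigma> True by simp
  ultimately show ?thesis by presburger
qed

text \<open>Exactly two vertices of \<sigma> are missing from \<tau>, and each of them completes
  \<tau> to a facet.\<close>

private lemma new_ridge:
  assumes \<tau>: "\<tau> \<in> star_face X \<sigma> v" "v \<in> \<tau>" "card \<tau> = d"
  shows "card {\<phi> \<in> star_face X \<sigma> v. card \<phi> = d + 1 \<and> \<tau> \<subseteq> \<phi>} = 2"
proof -
  have sub: "\<tau> - {v} \<subset> \<sigma>" using \<tau> in_star_face_new by blast
  have ft: "finite \<tau>" using simplicial_complex_star_face \<tau>(1) simplicial_complexD(2) by blast
  have "card \<sigma> = card (\<tau> - {v}) + 2" using \<tau> d \<sigma> ft by simp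
  then obtain x y where xy: "\<sigma> - (\<tau> - {v}) = {x, y}" "x \<noteq> y"
    using card_2_eq_cases[OF fin_\<sigma>, of "\<tau> - {v}"] sub by blast
  have xy\<sigma>: "x \<in> \<sigma>" "y \<in> \<sigma>" "x \<notin> \<tau>" "y \<notin> \<tau>" using xy v_notin_\<sigma> by blast+
  have "{\<phi> \<in> star_face X \<sigma> v. card \<phi> = d + 1 \<and> \<tau> \<subseteq> \<phi>} = {insert x \<tau>, insert y \<tau>}" (is "?F = _")
  proof
    show "?F \<subseteq> {insert x \<tau>, insert y \<tau>}"
    proof
      fix \<phi> assume p: "\<phi> \<in> ?F"
      then have "v \<in> \<phi>" using \<tau> by blast
      then have ps: "\<phi> - {v} \<subset> \<sigma>" using p in_star_face_new by blast
      then have "finite (\<phi> - {v})" using fin_\<sigma> finite_subset by blast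
      then have "finite \<phi>" by simp
      then obtain z where "z \<notin> \<tau>" "\<phi> = insert z \<tau>"
        using p \<tau>(3) card_Suc_superset[of \<phi> \<tau>] by auto
      moreover have "z \<in> {x, y}" using xy(1) calculation ps \<tau>(2) by blast
      ultimately show "\<phi> \<in> {insert x \<tau>, insert y \<tau>}" by blast
    qed
    have "insert x \<tau> - {v} \<subset> \<sigma>" "insert y \<tau> - {v} \<subset> \<sigma>" using sub xy xy\<sigma> by blast+
    then show "{insert x \<tau>, insert y \<tau>} \<subseteq> ?F"
      using in_star_face_new[of "insert x \<tau>"] in_star_face_new[of "insert y \<tau>"] \<tau> ft xy\<sigma> by auto
  qed
  moreover have "insert x \<tau> \<noteq> insert y \<tau>" using xy xy\<sigma> by blast
  ultimately show ?thesis by simp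
qed

text \<open>The edge graph of this link is complete: \<alpha> without \<open>v\<close>, together
  with two more vertices of \<sigma>, has at most d elements and so is a proper subset of
  \<sigma>.\<close>

private lemma new_link:
  assumes \<alpha>: "\<alpha> \<in> star_face X \<sigma> v" "v \<in> \<alpha>" "card \<alpha> \<le> d - 1"
  shows "complex_connected (link (star_face X \<sigma> v) \<alpha>)"
  unfolding complex_connected_iff_cut
proof (intro allI ballI impI)
  let ?L = "link (star_face X \<sigma> v) \<alpha>"
  note lk = in_link_iff[OF simplicial_complex_star_face]
  have sub: "\<alpha> - {v} \<subset> \<sigma>" using \<alpha> in_star_face_new by blast
  have f: "finite \<alpha>" using simplicial_complex_star_face \<alpha>(1) simplicial_complexD(2) by blast
  fix W u w assume uw: "u \<in> \<Union>?L" "w \<in> \<Union>?L" "u \<in> W" "w \<notin> W"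
  have vert: "x \<in> \<sigma> \<and> x \<notin> \<alpha>" if "x \<in> \<Union>?L" for x
  proof -
    have "{x} \<in> ?L" using that in_vertices_simplicial[OF simplicial_complex_link[OF simplicial_complex_star_face]] by blast
    then show ?thesis using lk in_star_face_new[of "\<alpha> \<union> {x}"] \<alpha>(2) by blast
  qed
  have "(\<alpha> - {v}) \<union> {u, w} \<subset> \<sigma>"
  proof (rule psubset_if_card_less)
    show "(\<alpha> - {v}) \<union> {u, w} \<subseteq> \<sigma>" using sub vert[OF uw(1)] vert[OF uw(2)] by blast
    have "card (\<alpha> - {v}) + 1 = card \<alpha>" using card_Suc_Diff1[OF f \<alpha>(2)] by simp
    then show "card ((\<alpha> - {v}) \<union> {u, w}) < card \<sigma>"
      using card_union_doubleton_le[of "\<alpha> - {v}" u w] \<alpha>(3) \<sigma>(2) by linarith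
  qed
  then have "(\<alpha> \<union> {u, w}) - {v} \<subset> \<sigma>"
    using vert[OF uw(1)] vert[OF uw(2)] v_notin_\<sigma> by blast
  then have "{u, w} \<in> ?L"
    using lk in_star_face_new[of "\<alpha> \<union> {u, w}"] \<alpha>(2) vert[OF uw(1)] vert[OF uw(2)] by blast
  with uw show "\<exists>x\<in>W. \<exists>y. y \<notin> W \<and> {x, y} \<in> ?L" by blast
qed

text \<open>For \<alpha> inside \<sigma> the link is itself starred: \<open>v\<close> is joined to
  all of \<sigma> - \<alpha>, and the face \<sigma> - \<alpha> is removed. The edge graph gains one
  vertex and can lose one edge, namely when \<sigma> - \<alpha> has two elements.\<close>

private lemma old_link:
  assumes \<alpha>: "\<alpha> \<in> X" "card \<alpha> \<le> d - 1"
  shows "complex_connected (link (star_face X \<sigma> v) \<alpha>) \<longleftrightarrow> complex_connected (link X \<alpha>)"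
    (is "complex_connected ?L' \<longleftrightarrow> complex_connected ?L")
proof (cases "\<alpha> \<subseteq> \<sigma>")
  case False
  have "\<beta> \<in> ?L' \<longleftrightarrow> \<beta> \<in> ?L" for \<beta>
  proof (cases "v \<in> \<beta>")
    case True
    then show ?thesis
      using in_star_face_new[of "\<alpha> \<union> \<beta>"] v_notin[of "\<alpha> \<union> \<beta>"] v_notin[OF \<alpha>(1)] False
      unfolding in_link_iff[OF simplicial_complex_star_face] in_link_iff[OF X] by blast
  next
    case v\<beta>: False
    then show ?thesis
      using in_star_face_old[of "\<alpha> \<union> \<beta>"] v_notin[OF \<alpha>(1)] False
      unfolding in_link_iff[OF simplicial_complex_star_face] in_link_iff[OF X] by blast
  qed
  then have "?L' = ?L" by (rule set_eqI)
  then show ?thesis by simp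
next
  case True
  have v\<alpha>: "v \<notin> \<alpha>" using v_notin[OF \<alpha>(1)] .
  have small: "card (\<alpha> \<union> {x}) < card \<sigma>" for x
    using card_Un_le[of \<alpha> "{x}"] \<alpha>(2) \<sigma>(2) d by simp
  have new: "\<beta> \<in> ?L' \<longleftrightarrow> \<beta> \<inter> \<alpha> = {} \<and> \<alpha> \<union> (\<beta> - {v}) \<subset> \<sigma>" if "v \<in> \<beta>" for \<beta>
  proof -
    have "(\<alpha> \<union> \<beta>) - {v} = \<alpha> \<union> (\<beta> - {v})" using v\<alpha> by blast
    then show ?thesis using in_star_face_new[of "\<alpha> \<union> \<beta>"] that
      unfolding in_link_iff[OF simplicial_complex_star_face] by simp
  qed
  have old: "\<beta> \<in> ?L' \<longleftrightarrow> \<beta> \<in> ?L \<and> \<alpha> \<union> \<beta> \<noteq> \<sigma>" if "v \<notin> \<beta>" for \<beta>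
    using in_star_face_old[of "\<alpha> \<union> \<beta>"] that v\<alpha>
    unfolding in_link_iff[OF simplicial_complex_star_face] in_link_iff[OF X] by blast
  have spoke: "{v, x} \<in> ?L' \<longleftrightarrow> x \<in> \<sigma> - \<alpha>" if "x \<noteq> v" for x
  proof -
    have "{v, x} - {v} = {x}" using that by blast
    then have "{v, x} \<in> ?L' \<longleftrightarrow> x \<notin> \<alpha> \<and> \<alpha> \<union> {x} \<subset> \<sigma>" using new[of "{v, x}"] v\<alpha> by simp
    then show ?thesis using True small[of x] by auto
  qed
  have clique: "{x, y} \<in> ?L" if "x \<in> \<sigma> - \<alpha>" "y \<in> \<sigma> - \<alpha>" for x y
    using in_link_iff[OF X, of "{x, y}" \<alpha>] down[OF \<sigma>(1), of "\<alpha> \<union> {x, y}"] that True by blast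
  have vL: "v \<notin> \<Union>?L" using v by (auto simp: link_def)
  have verts: "\<Union>?L' = insert v (\<Union>?L)"
  proof -
    note vs = in_vertices_simplicial[OF simplicial_complex_link]
    have "x \<in> \<Union>?L' \<longleftrightarrow> x \<in> insert v (\<Union>?L)" for x
    proof (cases "x = v")
      case True
      have "\<alpha> \<subset> \<sigma>" using \<open>\<alpha> \<subseteq> \<sigma>\<close> \<alpha>(2) \<sigma>(2) by auto
      then have "{v} \<in> ?L'" using new[of "{v}"] v\<alpha> by simp
      then show ?thesis using True by blast
    next
      case False
      have "\<alpha> \<union> {x} \<noteq> \<sigma>" using small[of x] by auto
      then show ?thesis
        using False old[of "{x}"] vs[OF simplicial_complex_star_face, of x \<alpha>] vs[OF X, of x \<alpha>] by simp
    qed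
    then show ?thesis by (rule set_eqI)
  qed
  have "\<sigma> - \<alpha> \<noteq> {}"
    using True \<alpha>(2) \<sigma>(2) by auto
  then obtain x0 where x0: "x0 \<in> \<sigma> - \<alpha>" by blast
  then have x0L: "x0 \<in> \<Union>?L" using clique[of x0 x0] by auto
  have nv: "x \<noteq> v" if "x \<in> \<sigma> - \<alpha>" for x using that v_notin_\<sigma> by blast
  show ?thesis
  proof
    assume c: "complex_connected ?L"
    show "complex_connected ?L'"
      unfolding complex_connected_iff_cut
    proof (intro allI ballI impI)
      fix W u w assume uw: "u \<in> \<Union>?L'" "w \<in> \<Union>?L'" "u \<in> W" "w \<notin> W"
      show "\<exists>x\<in>W. \<exists>y. y \<notin> W \<and> {x, y} \<in> ?L'"
      proof (cases "\<exists>u'\<in>\<Union>?L. \<exists>w'\<in>\<Union>?L. u' \<in> W \<and> w' \<notin> W")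
        case True
        then obtain u' w' where u'w': "u' \<in> \<Union>?L" "w' \<in> \<Union>?L" "u' \<in> W" "w' \<notin> W" by blast
        obtain x y where xy: "x \<in> W" "y \<notin> W" "{x, y} \<in> ?L"
          by (rule complex_connected_cutD[OF c u'w'])
        show ?thesis
        \<comment> \<open>If the crossing edge is the one removed, the detour from \<open>x\<close>
          through \<open>v\<close> to \<open>y\<close> crosses the cut.\<close>
        proof (cases "\<alpha> \<union> {x, y} = \<sigma>")
          case False
          have "v \<notin> {x, y}" using vL xy(3) by blast
          then show ?thesis using old[of "{x, y}"] xy False by blast
        next
          case eq: True
          have "x \<notin> \<alpha>" "y \<notin> \<alpha>" using xy(3) by (auto simp: link_def)
          then have m: "x \<in> \<sigma> - \<alpha>" "y \<in> \<sigma> - \<alpha>" using eq by blast+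
          then have "{v, x} \<in> ?L'" "{v, y} \<in> ?L'" using spoke nv by blast+
          moreover from this have "{x, v} \<in> ?L'" by (simp add: insert_commute)
          ultimately show ?thesis using xy(1,2) by (cases "v \<in> W") blast+
        qed
      next
        case False
        \<comment> \<open>The cut separates \<open>v\<close> from all old vertices, so any spoke
          crosses it.\<close>
        then have all: "a \<in> W \<longleftrightarrow> x0 \<in> W" if "a \<in> \<Union>?L" for a using that x0L by blast
        have "u = v \<or> u \<in> \<Union>?L" "w = v \<or> w \<in> \<Union>?L" using uw(1,2) verts by blast+
        then have "x0 \<in> W \<longleftrightarrow> v \<notin> W" using all[of u] all[of w] uw(3,4) by metis
        moreover have "{v, x0} \<in> ?L'" using spoke[of x0] nv[OF x0] x0 by blast
        moreover from this have "{x0, v} \<in> ?L'" by (simp add: insert_commute)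
        ultimately show ?thesis by blast
      qed
    qed
  next
    assume c: "complex_connected ?L'"
    show "complex_connected ?L"
      unfolding complex_connected_iff_cut
    proof (intro allI ballI impI)
      fix W u w assume uw: "u \<in> \<Union>?L" "w \<in> \<Union>?L" "u \<in> W" "w \<notin> W"
      then have uv: "u \<noteq> v" "w \<noteq> v" using vL by blast+
      have uw': "u \<in> \<Union>?L'" "w \<in> \<Union>?L'" using verts uw by blast+
      show "\<exists>x\<in>W. \<exists>y. y \<notin> W \<and> {x, y} \<in> ?L"
      proof (cases "\<exists>x\<in>\<sigma> - \<alpha>. \<exists>y\<in>\<sigma> - \<alpha>. x \<in> W \<and> y \<notin> W")
        case True
        then show ?thesis using clique by blast
      next
        case False
        \<comment> \<open>\<open>v\<close> is moved to the side of the cut that contains its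
          neighbours \<sigma> - \<alpha>. Then no spoke crosses, and the crossing edge belongs to
          the old link.\<close>
        then consider (all) "\<sigma> - \<alpha> \<subseteq> W" | (none) "(\<sigma> - \<alpha>) \<inter> W = {}" by blast
        then obtain x y where xy: "x \<in> W" "y \<notin> W" "x \<noteq> v" "y \<noteq> v" "{x, y} \<in> ?L'"
        proof cases
          case all
          obtain x y where xy: "x \<in> insert v W" "y \<notin> insert v W" "{x, y} \<in> ?L'"
            by (rule complex_connected_cutD[OF c uw', of "insert v W"]) (use uw uv in auto)
          have "x \<noteq> v" using spoke[of y] xy all by blast
          then show ?thesis using that[of x y] xy by simp
        next
          case none
          obtain x y where xy: "x \<in> W - {v}" "y \<notin> W - {v}" "{x, y} \<in> ?L'"
            by (rule complex_connected_cutD[OF c uw', of "W - {v}"]) (use uw uv in auto)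
          have "{y, x} \<in> ?L'" using xy(3) by (simp add: insert_commute)
          then have "y \<noteq> v" using spoke[of x] xy none by blast
          then show ?thesis using that[of x y] xy by simp
        qed
        then have "{x, y} \<in> ?L" using old[of "{x, y}"] by simp
        with xy show ?thesis by blast
      qed
    qed
  qed
qed

text \<open>From right to left this builds stacked spheres; from left to right it undoes a starring
  in the recognition of stacked spheres.\<close>

theorem npm_star_face_iff:
  "normal_pseudomanifold d (star_face X \<sigma> v) \<longleftrightarrow> normal_pseudomanifold d X"
proof -
  let ?X' = "star_face X \<sigma> v"
  let ?R = "\<lambda>X. \<forall>\<tau>\<in>X. card \<tau> = d \<longrightarrow> card {\<phi> \<in> X. card \<phi> = d + 1 \<and> \<tau> \<subseteq> \<phi>} = 2"
  let ?C = "\<lambda>X. \<forall>\<alpha>\<in>X. card \<alpha> \<le> d - 1 \<longrightarrow> complex_connected (link X \<alpha>)"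
  have mem: "\<alpha> \<in> ?X'" if "\<alpha> \<in> X" "card \<alpha> \<le> d" for \<alpha>
    using that \<sigma>(2) in_star_face_old[OF v_notin[of \<alpha>]] by auto
  have "?R ?X' \<longleftrightarrow> ?R X"
  proof
    assume r: "?R ?X'"
    show "?R X"
    proof (intro ballI impI)
      fix \<tau> assume t: "\<tau> \<in> X" "card \<tau> = d"
      then have "card {\<phi> \<in> ?X'. card \<phi> = d + 1 \<and> \<tau> \<subseteq> \<phi>} = 2" using r mem by simp
      then show "card {\<phi> \<in> X. card \<phi> = d + 1 \<and> \<tau> \<subseteq> \<phi>} = 2" using old_ridge[OF t] by simp
    qed
  next
    assume r: "?R X"
    show "?R ?X'"
    proof (intro ballI impI)
      fix \<tau> assume t: "\<tau> \<in> ?X'" "card \<tau> = d"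
      show "card {\<phi> \<in> ?X'. card \<phi> = d + 1 \<and> \<tau> \<subseteq> \<phi>} = 2"
      proof (cases "v \<in> \<tau>")
        case True
        then show ?thesis using new_ridge t by blast
      next
        case False
        then have "\<tau> \<in> X" using t in_star_face_old by blast
        then show ?thesis using old_ridge t r by simp
      qed
    qed
  qed
  moreover have "?C ?X' \<longleftrightarrow> ?C X"
  proof
    assume r: "?C ?X'"
    show "?C X"
    proof (intro ballI impI)
      fix \<alpha> assume a: "\<alpha> \<in> X" "card \<alpha> \<le> d - 1"
      then have "complex_connected (link ?X' \<alpha>)" using r mem by simp
      then show "complex_connected (link X \<alpha>)" using old_link[OF a] by simp
    qed
  next
    assume r: "?C X"
    show "?C ?X'"
    proof (intro ballI impI)
      fix \<alpha> assume a: "\<alpha> \<in> ?X'" "card \<alpha> \<le> d - 1"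
      show "complex_connected (link ?X' \<alpha>)"
      proof (cases "v \<in> \<alpha>")
        case True
        then show ?thesis using new_link a by blast
      next
        case False
        then have "\<alpha> \<in> X" using a in_star_face_old by blast
        then show ?thesis using old_link a r by simp
      qed
    qed
  qed
  ultimately show ?thesis
    unfolding normal_pseudomanifold_def using pure_dim_star_face_iff by blast
qed

lemma vertices_star_face: "\<Union>(star_face X \<sigma> v) = insert v (\<Union>X)"
proof -
  note vs = in_vertices_simplicial[OF simplicial_complex_star_face] in_vertices_simplicial[OF X]
  have "x \<in> \<Union>(star_face X \<sigma> v) \<longleftrightarrow> x \<in> insert v (\<Union>X)" for x
  proof (cases "x = v")
    case True
    have "\<sigma> \<noteq> {}" using \<sigma>(2) by auto
    then have "{v} \<in> star_face X \<sigma> v" using in_star_face_new[of "{v}"] by auto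
    then show ?thesis using True by blast
  next
    case False
    have "\<sigma> \<noteq> {x}" using \<sigma>(2) d by auto
    then show ?thesis using False in_star_face_old[of "{x}"] vs by simp
  qed
  then show ?thesis by (rule set_eqI)
qed

text \<open>The bound on \<open>d\<close> ensures that the removed face \<sigma> is not itself an
  edge.\<close>

lemma edges_star_face:
  assumes "2 \<le> d"
  shows "edges (star_face X \<sigma> v) = edges X \<union> (\<lambda>x. {v, x}) ` \<sigma>"
proof -
  have "e \<in> edges (star_face X \<sigma> v) \<longleftrightarrow> e \<in> edges X \<union> (\<lambda>x. {v, x}) ` \<sigma>" for e
  proof (cases "v \<in> e")
    case True
    have "e \<in> edges (star_face X \<sigma> v) \<longleftrightarrow> e - {v} \<subset> \<sigma> \<and> card e = 2"
      using in_star_face_new[OF True] by (auto simp: edges_def)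
    also have "\<dots> \<longleftrightarrow> e \<in> (\<lambda>x. {v, x}) ` \<sigma>"
    proof
      assume e: "e - {v} \<subset> \<sigma> \<and> card e = 2"
      then obtain x where "e = {v, x}" "x \<noteq> v" using True by (auto simp: card_2_iff)
      with e show "e \<in> (\<lambda>x. {v, x}) ` \<sigma>" by auto
    next
      assume "e \<in> (\<lambda>x. {v, x}) ` \<sigma>"
      then obtain x where x: "e = {v, x}" "x \<in> \<sigma>" by blast
      then have "x \<noteq> v" using v_notin_\<sigma> by blast
      moreover have "\<sigma> \<noteq> {x}" using \<sigma>(2) d by auto
      ultimately show "e - {v} \<subset> \<sigma> \<and> card e = 2" using x by auto
    qed
    finally show ?thesis using True v_notin by (auto simp: edges_def)
  next
    case False
    have "e \<noteq> \<sigma>" if "card e = 2" using that \<sigma>(2) assms by auto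
    then have "e \<in> edges (star_face X \<sigma> v) \<longleftrightarrow> e \<in> edges X"
      using in_star_face_old[OF False] by (auto simp: edges_def)
    then show ?thesis using False by auto
  qed
  then show ?thesis by (rule set_eqI)
qed

lemma card_edges_star_face:
  assumes "2 \<le> d"
  shows "card (edges (star_face X \<sigma> v)) = card (edges X) + (d + 1)"
proof -
  have "card ((\<lambda>x. {v, x}) ` \<sigma>) = card \<sigma>"
    by (rule card_image) (auto simp: inj_on_def doubleton_eq_iff)
  moreover have "edges X \<inter> (\<lambda>x. {v, x}) ` \<sigma> = {}" using v_notin by (auto simp: edges_def)
  ultimately show ?thesis
    unfolding edges_star_face[OF assms] using finite_edges[OF X] fin_\<sigma> \<sigma>(2)
    by (subst card_Un_disjoint) auto
qed

end

section \<open>Stacked spheres\<close>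

lemma npm_simplex_boundary:
  assumes S: "finite S" "card S = d + 2" and d: "1 \<le> d"
  shows "normal_pseudomanifold d (Pow S - {S})" (is "normal_pseudomanifold d ?X")
proof -
  have mem: "\<alpha> \<in> ?X \<longleftrightarrow> \<alpha> \<subset> S" for \<alpha> by blast
  have fin: "finite \<alpha>" if "\<alpha> \<subset> S" for \<alpha> using that S finite_subset by blast
  have sc: "simplicial_complex ?X"
    unfolding simplicial_complex_def mem using S fin by auto
  have le: "card \<alpha> \<le> d + 1" if "\<alpha> \<in> ?X" for \<alpha>
    using psubset_card_mono[OF S(1), of \<alpha>] that S(2) mem by simp
  have facet: "S - {a} \<in> ?X \<and> card (S - {a}) = d + 1" if "a \<in> S" for a
    using that S by auto
  have ext: "\<exists>\<phi>\<in>?X. \<alpha> \<subseteq> \<phi> \<and> card \<phi> = d + 1" if "\<alpha> \<in> ?X" for \<alpha>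
  proof -
    from that obtain a where "a \<in> S" "a \<notin> \<alpha>" by blast
    then show ?thesis using facet[of a] that by (intro bexI[of _ "S - {a}"]) auto
  qed
  have "S \<noteq> {}" using S(2) by auto
  then have "\<exists>\<sigma>\<in>?X. card \<sigma> = d + 1" using facet by blast
  then have "pure_dim d ?X"
    unfolding pure_dim_iff using sc le ext by blast
  moreover have "card {\<sigma> \<in> ?X. card \<sigma> = d + 1 \<and> \<tau> \<subseteq> \<sigma>} = 2" if t: "\<tau> \<in> ?X" "card \<tau> = d" for \<tau>
  proof -
    have "\<tau> \<subseteq> S" "finite \<tau>" using t fin by auto
    obtain x y where xy: "S - \<tau> = {x, y}" "x \<noteq> y"
      by (rule card_2_eq_cases[OF S(1), of \<tau>]) (use t S in auto)
    have n: "x \<notin> \<tau>" "y \<notin> \<tau>" "x \<in> S" "y \<in> S" using xy by blast+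
    have "{\<sigma> \<in> ?X. card \<sigma> = d + 1 \<and> \<tau> \<subseteq> \<sigma>} = {insert x \<tau>, insert y \<tau>}" (is "?F = _")
    proof
      show "?F \<subseteq> {insert x \<tau>, insert y \<tau>}"
      proof
        fix \<phi> assume p: "\<phi> \<in> ?F"
        then have "\<phi> \<subset> S" using mem by blast
        then obtain z where z: "z \<notin> \<tau>" "\<phi> = insert z \<tau>"
          using card_Suc_superset[of \<phi> \<tau>] p t fin by auto
        then have "z \<in> S - \<tau>" using \<open>\<phi> \<subset> S\<close> by blast
        then have "z = x \<or> z = y" unfolding xy(1) by simp
        then show "\<phi> \<in> {insert x \<tau>, insert y \<tau>}" using z(2) by auto
      qed
      have "insert x \<tau> \<subset> S" "insert y \<tau> \<subset> S" using n \<open>\<tau> \<subseteq> S\<close> xy(2) by blast+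
      then show "{insert x \<tau>, insert y \<tau>} \<subseteq> ?F"
        using n t \<open>finite \<tau>\<close> by auto
    qed
    moreover have "insert x \<tau> \<noteq> insert y \<tau>" using n xy(2) by blast
    ultimately show ?thesis by simp
  qed
  moreover have "complex_connected (link ?X \<alpha>)" if a: "\<alpha> \<in> ?X" "card \<alpha> \<le> d - 1" for \<alpha>
    unfolding complex_connected_iff_cut
  proof (intro allI ballI impI)
    fix W u w assume uw: "u \<in> \<Union>(link ?X \<alpha>)" "w \<in> \<Union>(link ?X \<alpha>)" "u \<in> W" "w \<notin> W"
    then have n: "u \<in> S" "w \<in> S" "u \<notin> \<alpha>" "w \<notin> \<alpha>" by (auto simp: link_def)
    have "\<alpha> \<union> {u, w} \<subset> S"
    proof (rule psubset_if_card_less)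
      show "\<alpha> \<union> {u, w} \<subseteq> S" using a n by blast
      show "card (\<alpha> \<union> {u, w}) < card S"
        using card_union_doubleton_le[of \<alpha> u w] a(2) S(2) d by linarith
    qed
    then have "{u, w} \<in> link ?X \<alpha>"
      using in_link_iff[OF sc, of "{u, w}" \<alpha>] n by blast
    then show "\<exists>x\<in>W. \<exists>y. y \<notin> W \<and> {x, y} \<in> link ?X \<alpha>" using uw by blast
  qed
  ultimately show ?thesis using d unfolding normal_pseudomanifold_def by blast
qed

text \<open>Every proper subset of \<sigma> lies in a subset of size \<open>d\<close>, hence below a
  new facet; a face other than \<sigma> that lies in no other old facet is such a proper
  subset.\<close>

lemma star_in_eq_star_face:
  assumes X: "pure_dim d X" and \<sigma>: "\<sigma> \<in> facets X" and v: "v \<notin> \<Union>X"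
  shows "star_in X \<sigma> v d = star_face X \<sigma> v"
proof
  have sc: "simplicial_complex X" using X by (simp add: pure_dim_def)
  note down = simplicial_complexD(3)[OF sc]
  have \<sigma>X: "\<sigma> \<in> X" "card \<sigma> = d + 1" using \<sigma> pure_dim_facets[OF X] by auto
  have fs: "finite \<sigma>" using sc \<sigma>X(1) by (rule simplicial_complexD(2))
  have sub: "\<exists>\<tau>'. \<tau> \<subseteq> \<tau>' \<and> \<tau>' \<subseteq> \<sigma> \<and> card \<tau>' = d" if psub: "\<tau> \<subset> \<sigma>" for \<tau>
  proof -
    from psub obtain a where "a \<in> \<sigma>" "a \<notin> \<tau>" by blast
    then show ?thesis using psub fs \<sigma>X(2) by (intro exI[of _ "\<sigma> - {a}"]) auto
  qed
  show "star_in X \<sigma> v d \<subseteq> star_face X \<sigma> v"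
  proof
    fix \<beta> assume "\<beta> \<in> star_in X \<sigma> v d"
    then consider (old) \<phi> where "\<phi> \<in> facets X" "\<phi> \<noteq> \<sigma>" "\<beta> \<subseteq> \<phi>"
      | (new) \<tau> where "\<tau> \<subseteq> \<sigma>" "card \<tau> = d" "\<beta> \<subseteq> \<tau> \<union> {v}"
      unfolding star_in_def down_closure_def by blast
    then show "\<beta> \<in> star_face X \<sigma> v"
    proof cases
      case old
      then have "\<phi> \<in> X" by (simp add: facets_def)
      then have "\<beta> \<in> X" using old down by blast
      moreover have "\<beta> \<noteq> \<sigma>" using \<sigma> old \<open>\<phi> \<in> X\<close> by (auto simp: facets_def)
      ultimately show ?thesis by (simp add: star_face_def)
    next
      case new
      then have psub: "\<tau> \<subset> \<sigma>" using \<sigma>X(2) by auto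
      show ?thesis
      proof (cases "v \<in> \<beta>")
        case True
        then have "\<beta> = insert v (\<beta> - {v})" "\<beta> - {v} \<subset> \<sigma>" using new(3) psub by blast+
        then show ?thesis unfolding star_face_def by blast
      next
        case False
        then have "\<beta> \<subset> \<sigma>" using new(3) psub by blast
        then show ?thesis using down[OF \<sigma>X(1), of \<beta>] by (auto simp: star_face_def)
      qed
    qed
  qed
  show "star_face X \<sigma> v \<subseteq> star_in X \<sigma> v d"
  proof
    fix \<beta> assume "\<beta> \<in> star_face X \<sigma> v"
    then consider (old) \<phi> where "\<phi> \<in> facets X" "\<phi> \<noteq> \<sigma>" "\<beta> \<subseteq> \<phi>" | (new) "\<exists>\<tau>. \<tau> \<subset> \<sigma> \<and> \<beta> \<subseteq> insert v \<tau>"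
    proof -
      assume *: "\<And>\<phi>. \<phi> \<in> facets X \<Longrightarrow> \<phi> \<noteq> \<sigma> \<Longrightarrow> \<beta> \<subseteq> \<phi> \<Longrightarrow> thesis"
        "\<exists>\<tau>. \<tau> \<subset> \<sigma> \<and> \<beta> \<subseteq> insert v \<tau> \<Longrightarrow> thesis"
      show thesis
      proof (cases "\<beta> \<in> X \<and> \<beta> \<noteq> \<sigma>")
        case True
        then obtain \<phi> where p: "\<phi> \<in> facets X" "\<beta> \<subseteq> \<phi>" using simplicial_extend_facet[OF sc] by blast
        show thesis
        proof (cases "\<phi> = \<sigma>")
          case eq: True
          then have "\<beta> \<subset> \<sigma>" using p True by blast
          then show thesis using *(2) by blast
        qed (use *(1) p in blast)
      next
        case False
        then have "\<beta> \<in> insert v ` {\<tau>. \<tau> \<subset> \<sigma>}"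
          using \<open>\<beta> \<in> star_face X \<sigma> v\<close> unfolding star_face_def by blast
        then show thesis using *(2) by blast
      qed
    qed
    then show "\<beta> \<in> star_in X \<sigma> v d"
    proof cases
      case old
      then show ?thesis unfolding star_in_def down_closure_def by blast
    next
      case new
      then obtain \<tau> where "\<tau> \<subset> \<sigma>" "\<beta> \<subseteq> insert v \<tau>" by blast
      moreover obtain \<tau>' where t': "\<tau> \<subseteq> \<tau>'" "\<tau>' \<subseteq> \<sigma>" "card \<tau>' = d"
        using sub[OF \<open>\<tau> \<subset> \<sigma>\<close>] by blast
      ultimately have "\<beta> \<subseteq> \<tau>' \<union> {v}" by blast
      then show ?thesis unfolding star_in_def down_closure_def using t' by blast
    qed
  qed
qed

text \<open>The edge count of minimal rigidity, with the subtracted terms moved across.\<close>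

definition minimal_edges :: "nat \<Rightarrow> 'a set set \<Rightarrow> bool" where
  "minimal_edges d X \<longleftrightarrow>
     card (edges X) + (d + 1) * (d + 1) = card (\<Union>X) * (d + 1) + ((d + 1) choose 2)"

lemma minimally_rigid_iff:
  "minimally_rigid (d + 1) d X \<longleftrightarrow> rigid (d + 1) d X \<and> minimal_edges d X"
proof -
  have "int (card (edges X)) = (int (card (vertices X)) - int d - 1) * int (d + 1) + int ((d + 1) choose 2)
     \<longleftrightarrow> int (card (edges X) + (d + 1) * (d + 1)) = int (card (\<Union>X) * (d + 1) + ((d + 1) choose 2))"
    unfolding of_nat_add of_nat_mult vertices_def by (simp add: algebra_simps)
  then show ?thesis
    unfolding minimally_rigid_def minimal_edges_def by linarith
qed

lemma choose_2_Suc: "Suc n choose 2 = (n choose 2) + n"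
  by (simp add: numeral_2_eq_2)

text \<open>The edge graph is complete on d + 2 vertices, and (d + 2) choose 2 is (d + 1) choose 2
  plus d + 1, the contribution of one vertex beyond a facet.\<close>

lemma minimal_edges_simplex_boundary:
  assumes S: "finite S" "card S = d + 2" "1 \<le> d"
  shows "minimal_edges d (Pow S - {S})"
proof -
  have "edges (Pow S - {S}) = {e. e \<subseteq> S \<and> card e = 2}"
    using assms by (auto simp: edges_def)
  then have "card (edges (Pow S - {S})) = Suc (d + 1) choose 2"
    using n_subsets[OF S(1), of 2] S(2) by simp
  moreover have "\<Union>(Pow S - {S}) = S"
  proof
    show "S \<subseteq> \<Union>(Pow S - {S})"
    proof
      fix x assume "x \<in> S"
      moreover have "{x} \<noteq> S" using S(2) by auto
      ultimately show "x \<in> \<Union>(Pow S - {S})" by blast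
    qed
  qed auto
  ultimately show ?thesis
    unfolding minimal_edges_def choose_2_Suc using S(2) by simp
qed

text \<open>One more vertex and d + 1 more edges add d + 1 to both sides of the count.\<close>

lemma minimal_edges_star_face_iff:
  assumes "2 \<le> d" "simplicial_complex X" "\<sigma> \<in> X" "card \<sigma> = d + 1" "v \<notin> \<Union>X"
    and "\<And>\<alpha>. \<alpha> \<in> X \<Longrightarrow> card \<alpha> \<le> d + 1"
  shows "minimal_edges d (star_face X \<sigma> v) \<longleftrightarrow> minimal_edges d X"
proof -
  have d: "1 \<le> d" using assms(1) by simp
  have "card (edges (star_face X \<sigma> v)) = card (edges X) + (d + 1)"
    by (rule card_edges_star_face[OF d assms(2-)  assms(1)])
  moreover have "\<Union>(star_face X \<sigma> v) = insert v (\<Union>X)"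
    by (rule vertices_star_face[OF d assms(2-)])
  then have "card (\<Union>(star_face X \<sigma> v)) = Suc (card (\<Union>X))"
    using finite_vertices[OF assms(2)] assms(5) by simp
  ultimately show ?thesis unfolding minimal_edges_def by (simp add: algebra_simps)
qed

lemma stacked_sphere_npm_minimal:
  assumes "2 \<le> d" "stacked_sphere d X"
  shows "normal_pseudomanifold d X \<and> minimal_edges d X"
  using assms(2)
proof induction
  case (base S)
  then show ?case using npm_simplex_boundary[of S d] minimal_edges_simplex_boundary[of S d] assms(1) by simp
next
  case (step X \<sigma> v)
  then have X: "normal_pseudomanifold d X" and v: "v \<notin> \<Union>X" by (auto simp: vertices_def)
  have \<sigma>: "\<sigma> \<in> X" "card \<sigma> = d + 1"
    using step pure_dim_facets[OF npm_pure[OF X]] by auto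
  have d: "1 \<le> d" using assms(1) by simp
  have "normal_pseudomanifold d (star_face X \<sigma> v) \<longleftrightarrow> normal_pseudomanifold d X"
    by (rule npm_star_face_iff[OF d npm_simplicial[OF X] \<sigma> v npm_card_le[OF X]])
  moreover have "minimal_edges d (star_face X \<sigma> v) \<longleftrightarrow> minimal_edges d X"
    by (rule minimal_edges_star_face_iff[OF assms(1) npm_simplicial[OF X] \<sigma> v npm_card_le[OF X]])
  ultimately show ?case
    using step X star_in_eq_star_face[OF npm_pure[OF X] _ v] by simp
qed

section \<open>Minimally rigid normal pseudomanifolds\<close>

text \<open>\<open>U\<close> is what a maximal connected set \<open>W\<close> with \<open>N[W] \<noteq> R\<close> leaves uncovered: every
  vertex of the boundary of \<open>W\<close> is joined to all of \<open>U\<close>, and this boundary is a clique.\<close>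

lemma exists_simplicial_vertex:
  assumes V: "finite V" and sym: "\<And>x y. E x y \<Longrightarrow> E y x"
    and chordal: "\<And>W x y w w'. grown E W \<Longrightarrow> W \<subseteq> V \<Longrightarrow> x \<in> V \<Longrightarrow> y \<in> V \<Longrightarrow> E x y \<Longrightarrow>
      w \<in> W \<Longrightarrow> w = x \<or> E w x \<Longrightarrow> w' \<in> W \<Longrightarrow> w' = y \<or> E w' y \<Longrightarrow>
      \<exists>u\<in>W. (u = x \<or> E u x) \<and> (u = y \<or> E u y)"
    and R: "R \<subseteq> V" "R \<noteq> {}"
  shows "\<exists>r\<in>R. \<forall>x\<in>R. \<forall>y\<in>R. E r x \<longrightarrow> E r y \<longrightarrow> x \<noteq> y \<longrightarrow> E x y"
  using R
proof (induction "card R" arbitrary: R rule: less_induct)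
  case less
  have fR: "finite R" using less.prems(1) V finite_subset by blast
  define near where "near W x \<longleftrightarrow> (\<exists>w\<in>W. w = x \<or> E w x)" for W x
  show ?case
  proof (cases "\<forall>x\<in>R. \<forall>y\<in>R. x \<noteq> y \<longrightarrow> E x y")
    case True
    then show ?thesis using less.prems(2) by blast
  next
    case False
    then obtain r s where rs: "r \<in> R" "s \<in> R" "r \<noteq> s" "\<not> E r s" by blast
    let ?Q = "\<lambda>n. \<exists>W. grown E W \<and> W \<subseteq> R \<and> (\<exists>u\<in>R. \<not> near W u) \<and> card W = n"
    have "?Q 1"
      using grown.single[of E r] rs by (intro exI[of _ "{r}"]) (auto simp: near_def)
    moreover have "n \<le> card R" if "?Q n" for n
      using that fR card_mono by blast
    ultimately obtain n where n: "?Q n" "\<And>m. ?Q m \<Longrightarrow> m \<le> n"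
      using Nat.ex_has_greatest_nat[of ?Q 1 "card R"] by blast
    then obtain W where W: "grown E W" "W \<subseteq> R" "\<exists>u\<in>R. \<not> near W u" "card W = n" by blast
    have fW: "finite W" "W \<noteq> {}" using grown_finite_nonempty[OF W(1)] by auto
    define U where "U = {u \<in> R. \<not> near W u}"
    have grownx: "grown E (insert x W)" if "near W x" "x \<notin> W" for x
      using that grown.grow[OF W(1)] by (auto simp: near_def)
    \<comment> \<open>Adding \<open>x\<close> to \<open>W\<close> keeps it connected, so by
      maximality nothing remains uncovered; in particular \<open>u\<close> must be adjacent to
      \<open>x\<close>.\<close>
    have join: "E x u" if x: "x \<in> R" "near W x" "x \<notin> W" and u: "u \<in> U" for x u
    proof (rule ccontr)
      assume nE: "\<not> E x u"
      have "u \<in> R" "\<not> near W u" using u by (auto simp: U_def)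
      moreover have "x \<noteq> u" using x(2) \<open>\<not> near W u\<close> by auto
      ultimately have "\<not> near (insert x W) u" using nE by (auto simp: near_def)
      moreover have "insert x W \<subseteq> R" using x(1) W(2) by simp
      ultimately have "?Q (card (insert x W))"
        using grownx[OF x(2,3)] \<open>u \<in> R\<close> by blast
      then have "card (insert x W) \<le> n" by (rule n(2))
      then show False using fW x(3) W(4) by simp
    qed
    have "U \<noteq> {}" using W(3) by (auto simp: U_def)
    moreover have "U \<subseteq> V" using less.prems(1) by (auto simp: U_def)
    moreover have "U \<subset> R"
    proof -
      obtain w where "w \<in> W" using fW(2) by blast
      then have "w \<in> R" "w \<notin> U" using W(2) by (auto simp: U_def near_def)
      then show ?thesis by (auto simp: U_def)
    qed
    then have "card U < card R" using fR by (rule psubset_card_mono[rotated])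
    ultimately obtain u where u: "u \<in> U" and
      IH: "\<And>x y. x \<in> U \<Longrightarrow> y \<in> U \<Longrightarrow> E u x \<Longrightarrow> E u y \<Longrightarrow> x \<noteq> y \<Longrightarrow> E x y"
      using less.hyps[of U] by blast
    have uR: "u \<in> R" "\<not> near W u" using u by (auto simp: U_def)
    have "E x y" if xy: "x \<in> R" "y \<in> R" "E u x" "E u y" "x \<noteq> y" for x y
    proof -
      have notW: "x \<notin> W" "y \<notin> W" using xy sym uR(2) by (auto simp: near_def)
      consider "x \<in> U" "y \<in> U" | "x \<in> U" "near W y" | "near W x" "y \<in> U" | "near W x" "near W y"
        using xy by (auto simp: U_def)
      then show ?thesis
      proof cases
        case 1
        then show ?thesis using IH xy by blast
      next
        case 2
        then show ?thesis using join[of y x] xy notW sym by blast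
      next
        case 3
        then show ?thesis using join[of x y] xy notW by blast
      next
        case 4
        \<comment> \<open>Apply \<open>chordal\<close> to the connected set
          \<open>insert x W\<close> and the edge from \<open>u\<close> to \<open>y\<close>. The
          common neighbour it provides is not in \<open>W\<close>, because \<open>u\<close> is not
          near \<open>W\<close>; so it is \<open>x\<close>.\<close>
        have "E x u" using sym xy(3) .
        from 4(2) obtain w where w: "w \<in> insert x W" "w = y \<or> E w y" by (auto simp: near_def)
        have "\<exists>v\<in>insert x W. (v = u \<or> E v u) \<and> (v = y \<or> E v y)"
          by (rule chordal[OF grownx[OF 4(1) notW(1)] _ _ _ xy(4) insertI1 disjI2[OF \<open>E x u\<close>] w])
            (use xy W(2) uR less.prems(1) in auto)
        then obtain v where v: "v \<in> insert x W" "v = u \<or> E v u" "v = y \<or> E v y" by blast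
        have "v \<notin> W" using v(2) uR(2) by (auto simp: near_def)
        then show ?thesis using v xy(5) by simp
      qed
    qed
    then show ?thesis using uR(1) by blast
  qed
qed

section \<open>Rigid subcomplexes, chordality and cliques under minimality\<close>

text \<open>Rigidity of \<open>Y\<close>, applied to its vertices outside \<sigma>, bounds the edges
  of \<open>Y\<close> from below. Rigidity of \<open>X\<close>, applied to its vertices outside
  \<open>Y\<close>, bounds the edges of \<open>X\<close> among the vertices of \<open>Y\<close> from
  above. Minimality makes the two bounds equal.\<close>

lemma minimal_edges_rigid_subcomplex:
  assumes d: "2 \<le> d" and X: "normal_pseudomanifold d X" and min: "minimal_edges d X"
    and Y: "Y \<subseteq> X" "simplicial_complex Y" "face_rigid (d + 1) d Y" "\<sigma> \<in> Y" "card \<sigma> = d + 1"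
  shows "{e \<in> edges X. e \<subseteq> \<Union>Y} = edges Y" and "minimal_edges d Y"
proof -
  let ?q = "d + 1" and ?B = "{e \<in> edges X. e \<subseteq> \<Union>Y}"
  have fV: "finite (\<Union>X)" using finite_vertices[OF npm_simplicial[OF X]] .
  have fE: "finite (edges X)" using finite_edges[OF npm_simplicial[OF X]] .
  have fVY: "finite (\<Union>Y)" using finite_vertices[OF Y(2)] .
  have fEY: "finite (edges Y)" using finite_edges[OF Y(2)] .
  have \<sigma>Y: "\<sigma> \<subseteq> \<Union>Y" and YX: "\<Union>Y \<subseteq> \<Union>X" using Y(1,4) by blast+
  have f\<sigma>: "finite \<sigma>" using \<sigma>Y fVY finite_subset by blast
  have sub: "edges Y \<subseteq> ?B" using Y(1) by (auto simp: edges_def)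

  let ?E1 = "{e \<in> edges Y. e \<inter> (\<Union>Y - \<sigma>) \<noteq> {}}" and ?E2 = "{e. e \<subseteq> \<sigma> \<and> card e = 2}"
  have "?q * card (\<Union>Y - \<sigma>) \<le> card ?E1"
    by (rule face_rigidD[OF Y(3) _ Y(4,5)]) auto
  moreover have "card ?E2 = ?q choose 2" using n_subsets[OF f\<sigma>, of 2] Y(5) by simp
  moreover have "card ?E1 + card ?E2 = card (?E1 \<union> ?E2)"
    using fEY f\<sigma> by (intro card_Un_disjoint[symmetric]) auto
  moreover have "?E2 \<subseteq> edges Y"
    using simplicial_complexD(3)[OF Y(2,4)] by (auto simp: edges_def)
  then have "card (?E1 \<union> ?E2) \<le> card (edges Y)"
    using fEY by (intro card_mono) auto
  ultimately have low: "?q * card (\<Union>Y - \<sigma>) + (?q choose 2) \<le> card (edges Y)" by linarith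
  have cY: "card (\<Union>Y) = card (\<Union>Y - \<sigma>) + ?q"
    using card_Int_Diff[OF fVY, of \<sigma>] \<sigma>Y Y(5) by (simp add: Int_absorb1)

  let ?E3 = "{e \<in> edges X. e \<inter> (\<Union>X - \<Union>Y) \<noteq> {}}"
  have "?q * card (\<Union>X - \<Union>Y) \<le> card ?E3"
    by (rule face_rigidD[OF npm_face_rigid[OF d X], of _ \<sigma>]) (use Y \<sigma>Y in auto)
  moreover have "card ?E3 + card ?B = card (?E3 \<union> ?B)"
    using fE by (intro card_Un_disjoint[symmetric]) auto
  moreover have "card (?E3 \<union> ?B) \<le> card (edges X)"
    using fE by (intro card_mono) auto
  ultimately have up: "?q * card (\<Union>X - \<Union>Y) + card ?B \<le> card (edges X)" by linarith
  have cX: "card (\<Union>X) = card (\<Union>X - \<Union>Y) + card (\<Union>Y)"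
    using card_Int_Diff[OF fV, of "\<Union>Y"] YX by (simp add: Int_absorb1)

  have "card (edges X) = ?q * card (\<Union>X - \<Union>Y) + ?q * card (\<Union>Y - \<sigma>) + (?q choose 2)"
    using min unfolding minimal_edges_def cX cY by (simp add: algebra_simps)
  then have "card ?B \<le> ?q * card (\<Union>Y - \<sigma>) + (?q choose 2)" using up by linarith
  moreover have "card (edges Y) \<le> card ?B" using fE sub by (intro card_mono) auto
  ultimately have eq: "card (edges Y) = card ?B" "card (edges Y) = ?q * card (\<Union>Y - \<sigma>) + (?q choose 2)"
    using low by linarith+
  show "?B = edges Y" using card_subset_eq[OF _ sub eq(1)] fE by simp
  show "minimal_edges d Y" unfolding minimal_edges_def cY eq(2) by (simp add: algebra_simps)
qed

lemma simplicial_complex_stars: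
  assumes "simplicial_complex X" shows "simplicial_complex (\<Union>w\<in>W. star X w)"
proof -
  have "(\<Union>w\<in>W. star X w) \<subseteq> X" by (auto simp: star_def)
  then have "finite (\<Union>w\<in>W. star X w)" "\<And>\<beta>. \<beta> \<in> (\<Union>w\<in>W. star X w) \<Longrightarrow> finite \<beta>"
    using assms finite_subset by (auto simp: simplicial_complex_def)
  moreover have "\<alpha> \<in> (\<Union>w\<in>W. star X w)" if "\<beta> \<in> (\<Union>w\<in>W. star X w)" "\<alpha> \<subseteq> \<beta>" for \<alpha> \<beta>
    using that star_down[OF assms] by blast
  ultimately show ?thesis by (auto simp: simplicial_complex_def)
qed

lemma npm_star_face_rigid:
  assumes "3 \<le> d" "normal_pseudomanifold d X" "v \<in> \<Union>X"
  shows "face_rigid (d + 1) d (star X v)"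
proof -
  obtain k where k: "d = Suc k" "2 \<le> k" using assms(1) by (cases d) auto
  have "normal_pseudomanifold k (link X {v})"
    using npm_link_vertex[of k X v] assms k by simp
  from face_rigid_star[of k X v "k + 1"] npm_face_rigid[OF k(2) this]
  show ?thesis using assms k(1) by simp
qed

text \<open>The union of the stars over \<open>W\<close> is rigid and has \<open>x\<close> and
  \<open>y\<close> as vertices, so the edge between them lies in the star of some \<open>u\<close>
  in \<open>W\<close>. For a path \<open>W\<close> of at least two vertices avoiding
  \<open>x\<close> and \<open>y\<close>, this gives a chord in the cycle that it closes with the
  edge.\<close>

lemma minimal_edges_chordal:
  assumes d: "3 \<le> d" and X: "normal_pseudomanifold d X" and min: "minimal_edges d X"
    and W: "grown (adj X) W" "W \<subseteq> \<Union>X"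
    and x: "w \<in> W" "{w, x} \<in> X" and y: "w' \<in> W" "{w', y} \<in> X" and xy: "{x, y} \<in> edges X"
  shows "\<exists>u\<in>W. {u, x, y} \<in> X"
proof -
  note sc = npm_simplicial[OF X]
  let ?Y = "\<Union>w\<in>W. star X w"
  have r: "face_rigid (d + 1) d ?Y"
    by (rule face_rigid_stars[OF X npm_star_face_rigid[OF d X] W])
  have "{w, w} \<in> X" using npm_down[OF X x(2)] by simp
  then obtain \<rho> where \<rho>: "\<rho> \<in> star X w" "card \<rho> = d + 1" by (rule star_facet[OF X]) 
  have 2: "2 \<le> d" using d by simp
  have sub: "?Y \<subseteq> X" by (auto simp: star_def)
  have \<rho>Y: "\<rho> \<in> ?Y" using \<rho>(1) x(1) by blast
  have "{e \<in> edges X. e \<subseteq> \<Union>?Y} = edges ?Y"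
    by (rule minimal_edges_rigid_subcomplex(1)[OF 2 X min sub simplicial_complex_stars[OF sc] r \<rho>Y \<rho>(2)])
  moreover have "x \<in> \<Union>(star X w)" "y \<in> \<Union>(star X w')"
    using in_vertices_star[OF sc] x(2) y(2) by blast+
  then have "{x, y} \<subseteq> \<Union>?Y" using x(1) y(1) by blast
  ultimately have "{x, y} \<in> edges ?Y" using xy by blast
  then show ?thesis by (auto simp: edges_def star_def)
qed

lemma minimal_edges_triangle:
  assumes d: "3 \<le> d" and X: "normal_pseudomanifold d X" and min: "minimal_edges d X"
    and "{a, x} \<in> X" "{a, y} \<in> X" "{x, y} \<in> X"
  shows "{a, x, y} \<in> X"
proof (cases "x = y")
  case False
  then have "{x, y} \<in> edges X" using assms by (simp add: doubleton_in_edges)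
  moreover have "{a} \<subseteq> \<Union>X" using assms by blast
  ultimately show ?thesis
    using minimal_edges_chordal[OF d X min grown.single, of a a x a y] assms by simp
qed (use assms in simp)

text \<open>The star is a rigid subcomplex and hence minimal itself. Removing its apex takes away
  one vertex and as many edges as the link has vertices, which turns the count for dimension k + 1
  into the one for \<open>k\<close>.\<close>

lemma minimal_edges_link:
  assumes d: "3 \<le> Suc k" and X: "normal_pseudomanifold (Suc k) X" and min: "minimal_edges (Suc k) X"
    and v: "v \<in> \<Union>X"
  shows "minimal_edges k (link X {v})"
proof -
  note sc = npm_simplicial[OF X]
  have "{v, v} \<in> X" using v npm_down[OF X] by simp blast
  then obtain \<rho> where \<rho>: "\<rho> \<in> star X v" "card \<rho> = Suc k + 1" by (rule star_facet[OF X])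
  have scs: "simplicial_complex (star X v)" using simplicial_complex_stars[OF sc, of "{v}"] by simp
  have 2: "2 \<le> Suc k" using d by simp
  have "minimal_edges (Suc k) (star X v)"
    by (rule minimal_edges_rigid_subcomplex(2)[OF 2 X min star_subset scs npm_star_face_rigid[OF d X v] \<rho>])
  moreover let ?L = "link X {v}"
  have fL: "finite (\<Union>?L)" "finite (edges ?L)"
    using simplicial_complex_link[OF sc] finite_vertices finite_edges by auto
  have "card (\<Union>(star X v)) = Suc (card (\<Union>?L))"
    unfolding vertices_star[OF sc v] using fL notin_vertices_link by (intro card_insert_disjoint)
  moreover have "card (edges (star X v)) = card (edges ?L) + card (\<Union>?L)"
  proof -
    have "card ((\<lambda>x. {v, x}) ` \<Union>?L) = card (\<Union>?L)"
      by (rule card_image) (auto simp: inj_on_def doubleton_eq_iff)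
    moreover have "edges ?L \<inter> (\<lambda>x. {v, x}) ` \<Union>?L = {}"
      using notin_vertices_link[of v X] by (auto simp: edges_def)
    ultimately show ?thesis
      unfolding edges_star[OF sc v] using fL by (subst card_Un_disjoint) auto
  qed
  moreover have "(Suc k + 1) choose 2 = ((k + 1) choose 2) + (k + 1)"
    using choose_2_Suc[of "k + 1"] by simp
  ultimately show ?thesis
    unfolding minimal_edges_def by (simp add: algebra_simps)
qed

text \<open>Triangles are filled, so a clique through \<open>a\<close> induces a clique in the link
  of \<open>a\<close>, one dimension lower. Size \<open>d\<close> is the limit: starring a facet
  leaves its d + 1 vertices as a clique that is no longer a face.\<close>

lemma minimal_edges_clique:
  assumes "3 \<le> d" "normal_pseudomanifold d X" "minimal_edges d X"
    and "finite C" "card C \<le> d" "\<And>x y. x \<in> C \<Longrightarrow> y \<in> C \<Longrightarrow> {x, y} \<in> X"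
  shows "C \<in> X"
  using assms
proof (induction d arbitrary: X C rule: dec_induct)
  case base
  note X = base(1)
  have "card C = 0 \<or> card C = 1 \<or> card C = 2 \<or> card C = 3" using base(4) by linarith
  then consider "C = {}" | "card C = 1" | "card C = 2" | "card C = 3" using base(3) by fastforce
  then show ?case
  proof cases
    case 1
    then show ?thesis using npm_empty[OF X] by simp
  next
    case 2
    then obtain x where "C = {x}" by (auto simp: card_1_singleton_iff)
    then show ?thesis using base(5)[of x x] by simp
  next
    case 3
    then obtain x y where "C = {x, y}" by (auto simp: card_2_iff)
    then show ?thesis using base(5)[of x y] by simp
  next
    case 4
    then obtain x y z where C: "C = {x, y, z}" by (auto simp: card_3_iff)
    have "{x, y, z} \<in> X"
      by (rule minimal_edges_triangle[OF _ X base(2)]) (use base(5) C in auto)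
    then show ?thesis using C by simp
  qed
next
  case (step d)
  note X = step.prems(1) and min = step.prems(2) and sc = npm_simplicial[OF step.prems(1)]
  show ?case
  proof (cases "C = {}")
    case True
    then show ?thesis using npm_empty[OF X] by simp
  next
    case False
    then obtain a where a: "a \<in> C" by blast
    have aX: "a \<in> \<Union>X" using step.prems(5)[OF a a] by blast
    have "C - {a} \<in> link X {a}"
    proof (rule step.IH)
      show "normal_pseudomanifold d (link X {a})"
        using npm_link_vertex[OF X _ aX] step.hyps by simp
      show "minimal_edges d (link X {a})"
        using minimal_edges_link[OF _ X min aX] step.hyps by simp
      show "finite (C - {a})" "card (C - {a}) \<le> d" using step.prems a by auto
      fix x y assume xy: "x \<in> C - {a}" "y \<in> C - {a}"
      have "{a, x, y} \<in> X"
        by (rule minimal_edges_triangle[OF _ X min]) (use step.hyps step.prems(5) a xy in auto)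
      then show "{x, y} \<in> link X {a}" using xy by (auto simp: in_link_vertex[OF sc])
    qed
    then show ?thesis using a by (simp add: in_link_vertex[OF sc] insert_absorb)
  qed
qed

section \<open>A simplicial vertex, its link, and the recognition of stacked spheres\<close>

lemma minimal_edges_exists_simplicial_vertex:
  assumes d: "3 \<le> d" and X: "normal_pseudomanifold d X" and min: "minimal_edges d X"
  obtains r where "r \<in> \<Union>X"
    and "\<And>x y. {r, x} \<in> X \<Longrightarrow> {r, y} \<in> X \<Longrightarrow> {x, y} \<in> X"
proof -
  note sc = npm_simplicial[OF X]
  have sing: "{x} \<in> X" if "x \<in> \<Union>X" for x using in_vertices_simplicial[OF sc] that by blast
  have adjI: "w = x \<or> adj X w x" if "{w, x} \<in> X" for w x
    using that by (auto simp: doubleton_in_edges)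
  have "\<Union>X \<noteq> {}"
  proof -
    obtain \<sigma> where "\<sigma> \<in> X" "card \<sigma> = d + 1" using npm_ex_facet[OF X] by blast
    moreover from this have "\<sigma> \<noteq> {}" by auto
    ultimately show ?thesis by blast
  qed
  have "\<exists>r\<in>\<Union>X. \<forall>x\<in>\<Union>X. \<forall>y\<in>\<Union>X. adj X r x \<longrightarrow> adj X r y \<longrightarrow> x \<noteq> y \<longrightarrow> adj X x y"
  proof (rule exists_simplicial_vertex[OF finite_vertices[OF sc] _ _ subset_refl \<open>\<Union>X \<noteq> {}\<close>])
    fix x y show "adj X x y \<Longrightarrow> adj X y x" by (simp add: insert_commute)
  next
    fix W x y w w'
    assume W: "grown (adj X) W" "W \<subseteq> \<Union>X" and xy: "x \<in> \<Union>X" "y \<in> \<Union>X" "adj X x y"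
      and w: "w \<in> W" "w = x \<or> adj X w x" and w': "w' \<in> W" "w' = y \<or> adj X w' y"
    have "{w, x} \<in> X" "{w', y} \<in> X"
      using w(2) w'(2) sing[OF xy(1)] sing[OF xy(2)] by (auto simp: edges_def)
    then obtain u where u: "u \<in> W" "{u, x, y} \<in> X"
      using minimal_edges_chordal[OF d X min W w(1) _ w'(1) _ xy(3)] by blast
    then have "{u, x} \<in> X" "{u, y} \<in> X" using npm_down[OF X u(2)] by simp_all
    then show "\<exists>u\<in>W. (u = x \<or> adj X u x) \<and> (u = y \<or> adj X u y)" using u(1) adjI by blast
  qed
  then obtain r where r: "r \<in> \<Union>X"
    "\<And>x y. x \<in> \<Union>X \<Longrightarrow> y \<in> \<Union>X \<Longrightarrow> adj X r x \<Longrightarrow> adj X r y \<Longrightarrow> x \<noteq> y \<Longrightarrow> adj X x y"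
    by blast
  have "{x, y} \<in> X" if xy: "{r, x} \<in> X" "{r, y} \<in> X" for x y
  proof -
    have v: "x \<in> \<Union>X" "y \<in> \<Union>X" using xy by blast+
    show ?thesis
    proof (cases "x = r \<or> y = r \<or> x = y")
      case True
      then show ?thesis using xy sing[OF v(1)] by (auto simp: insert_commute)
    next
      case False
      then have "adj X x y" using r(2)[OF v] xy by (auto simp: doubleton_in_edges)
      then show ?thesis by (simp add: edges_def)
    qed
  qed
  with r(1) that show ?thesis by blast
qed

lemma card_choose_2_extend: "(m + t) choose 2 = (m choose 2) + m * t + (t choose 2)"
proof (induction t)
  case (Suc t)
  have "(m + Suc t) choose 2 = ((m + t) choose 2) + (m + t)" using choose_2_Suc[of "m + t"] by simp
  then show ?case using Suc choose_2_Suc[of t] by (simp add: algebra_simps)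
qed simp

text \<open>The link of a simplicial vertex has a complete edge graph, which is too dense for
  minimality unless the vertex has the least possible degree.\<close>

lemma minimal_edges_simplicial_vertex:
  assumes d: "3 \<le> d" and X: "normal_pseudomanifold d X" and min: "minimal_edges d X"
    and r: "r \<in> \<Union>X" "\<And>x y. {r, x} \<in> X \<Longrightarrow> {r, y} \<in> X \<Longrightarrow> {x, y} \<in> X"
  defines "N \<equiv> \<Union>(link X {r})"
  shows "card N = d + 1" and "\<And>\<tau>. \<tau> \<subset> N \<Longrightarrow> insert r \<tau> \<in> X"
proof -
  note sc = npm_simplicial[OF X]
  obtain k where k: "d = Suc k" "2 \<le> k" using d by (cases d) auto
  let ?L = "link X {r}"
  have L: "normal_pseudomanifold k ?L"
    using npm_link_vertex[of k X r] X r(1) k by simp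
  have minL: "minimal_edges k ?L"
    using minimal_edges_link[of k X r] X min r(1) k d by simp
  have fN: "finite N" using finite_vertices[OF npm_simplicial[OF L]] by (simp add: N_def)
  have rN: "r \<notin> N" using notin_vertices_link by (simp add: N_def)
  have NX: "{r, x} \<in> X" if "x \<in> N" for x
    using that vertices_star[OF sc r(1)] in_vertices_star[OF sc, of x r] by (simp add: N_def)
  have edgeL: "{x, y} \<in> ?L" if "x \<in> N" "y \<in> N" for x y
  proof -
    have "{r, x, y} \<in> X"
      using minimal_edges_triangle[OF d X min NX[OF that(1)] NX[OF that(2)]] r(2) NX that by blast
    moreover have "r \<noteq> x" "r \<noteq> y" using that rN by blast+
    ultimately show ?thesis by (simp add: in_link_vertex[OF sc])
  qed
  have "edges ?L = {e. e \<subseteq> N \<and> card e = 2}"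
  proof
    show "edges ?L \<subseteq> {e. e \<subseteq> N \<and> card e = 2}" by (auto simp: edges_def N_def)
    show "{e. e \<subseteq> N \<and> card e = 2} \<subseteq> edges ?L"
    proof
      fix e assume e: "e \<in> {e. e \<subseteq> N \<and> card e = 2}"
      then obtain x y where "e = {x, y}" by (auto simp: card_2_iff)
      with e edgeL show "e \<in> edges ?L" by (auto simp: edges_def)
    qed
  qed
  then have count: "(card N choose 2) + (k + 1) * (k + 1) = card N * (k + 1) + ((k + 1) choose 2)"
    using minL n_subsets[OF fN, of 2] by (simp add: minimal_edges_def N_def)
  \<comment> \<open>On at most k + 1 vertices the link could have no facet but \<open>N\<close>,
    whereas each ridge lies in two.\<close>
  have "k + 1 < card N"
  proof -
    obtain \<beta> where b: "\<beta> \<in> ?L" "card \<beta> = k + 1" using npm_ex_facet[OF L] by blast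
    then obtain b0 where "b0 \<in> \<beta>" by fastforce
    have fb: "finite \<beta>" using npm_finite(2)[OF L b(1)] .
    have "\<beta> - {b0} \<in> ?L" "card (\<beta> - {b0}) = k"
      using npm_down[OF L b(1)] b \<open>b0 \<in> \<beta>\<close> fb by auto
    from npm_ridge[OF L this]
    have two: "card {\<sigma> \<in> ?L. card \<sigma> = k + 1 \<and> \<beta> - {b0} \<subseteq> \<sigma>} = 2" (is "card ?F = 2") .
    have bN: "\<beta> \<subseteq> N" using b by (auto simp: N_def)
    show ?thesis
    proof (rule ccontr)
      assume "\<not> k + 1 < card N"
      then have all: "\<sigma> = N" if "\<sigma> \<in> ?F" for \<sigma>
        using that card_seteq[OF fN, of \<sigma>] by (auto simp: N_def)
      then have "?F \<subseteq> {N}" by blast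
      then have "card ?F \<le> card {N}" by (intro card_mono) simp_all
      then show False using two by simp
    qed
  qed
  then obtain t where t: "card N = (k + 1) + t" "0 < t"
    by (metis less_imp_add_positive)
  \<comment> \<open>Expanding the complete graph on k + 1 + t vertices, everything else in
    \<open>count\<close> cancels.\<close>
  have "t choose 2 = 0"
    using count card_choose_2_extend[of "k + 1" t] unfolding t(1) by (simp add: algebra_simps)
  then have "t < 2" by (simp add: binomial_eq_0_iff)
  then show cN: "card N = d + 1" using t k by simp

  \<comment> \<open>Without \<open>a\<close> the set is a clique of size \<open>d\<close>, hence a
    ridge. Its two facets contain \<open>r\<close>, so each adds a vertex of \<open>N\<close>; only
    two such vertices are left, and \<open>a\<close> is one of them.\<close>
  have full: "insert r \<tau> \<in> X" if \<tau>: "\<tau> \<subseteq> N" "card \<tau> = d" for \<tau>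
  proof -
    have f\<tau>: "finite \<tau>" using \<tau>(1) fN finite_subset by blast
    obtain a where a: "a \<in> \<tau>" using \<tau>(2) d by fastforce
    let ?\<rho> = "insert r (\<tau> - {a})"
    have r\<tau>: "r \<notin> \<tau>" using \<tau>(1) rN by blast
    have c\<rho>: "card ?\<rho> = d" using a \<tau> f\<tau> r\<tau> d by simp
    have "?\<rho> \<in> X"
    proof (rule minimal_edges_clique[OF d X min])
      show "finite ?\<rho>" "card ?\<rho> \<le> d" using f\<tau> c\<rho> by simp_all
      have nb: "{r, x} \<in> X" if "x \<in> ?\<rho>" for x
      proof (cases "x = r")
        case True
        then show ?thesis using in_vertices_simplicial[OF sc] r(1) by simp
      qed (use that \<tau>(1) NX in blast)
      fix x y assume "x \<in> ?\<rho>" "y \<in> ?\<rho>"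
      then show "{x, y} \<in> X" using nb r(2) by blast
    qed
    then have two: "card {\<phi> \<in> X. card \<phi> = d + 1 \<and> ?\<rho> \<subseteq> \<phi>} = 2" (is "card ?F = 2")
      using npm_ridge[OF X _ c\<rho>] by simp
    obtain x y where xy: "N - (\<tau> - {a}) = {x, y}" "x \<noteq> y"
      by (rule card_2_eq_cases[OF fN, of "\<tau> - {a}"]) (use \<tau> a f\<tau> cN d in auto)
    have F: "\<phi> = insert x ?\<rho> \<or> \<phi> = insert y ?\<rho>" if p: "\<phi> \<in> ?F" for \<phi>
    proof -
      have pX: "\<phi> \<in> X" "card \<phi> = d + 1" "?\<rho> \<subseteq> \<phi>" using p by blast+
      have "finite \<phi>" using npm_finite(2)[OF X pX(1)] .
      then obtain z where z: "z \<notin> ?\<rho>" "\<phi> = insert z ?\<rho>"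
        using card_Suc_superset[of \<phi> ?\<rho>] pX c\<rho> by auto
      have "\<phi> - {r} \<in> ?L" using pX by (auto simp: in_link_vertex[OF sc] insert_absorb)
      moreover have "z \<in> \<phi> - {r}" using z by blast
      ultimately have "z \<in> N" unfolding N_def by blast
      then have "z \<in> {x, y}" unfolding xy(1)[symmetric] using z(1) by blast
      then show ?thesis using z(2) by blast
    qed
    have "?F \<subseteq> {insert x ?\<rho>, insert y ?\<rho>}"
    proof
      fix \<phi> assume "\<phi> \<in> ?F"
      from F[OF this] show "\<phi> \<in> {insert x ?\<rho>, insert y ?\<rho>}" by simp
    qed
    moreover have "card {insert x ?\<rho>, insert y ?\<rho>} \<le> card ?F"
      unfolding two by (simp add: card_insert_if)
    ultimately have "?F = {insert x ?\<rho>, insert y ?\<rho>}"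
      by (rule card_seteq[rotated]) simp
    moreover have "a \<in> N - (\<tau> - {a})" using a \<tau>(1) by blast
    then have "a \<in> {x, y}" unfolding xy(1) .
    ultimately have "insert a ?\<rho> \<in> ?F" by blast
    moreover have "insert a ?\<rho> = insert r \<tau>" using a by blast
    ultimately show ?thesis by simp
  qed
  show "insert r \<tau> \<in> X" if psub: "\<tau> \<subset> N" for \<tau>
  proof -
    from psub obtain a where a: "a \<in> N" "a \<notin> \<tau>" by blast
    have "insert r (N - {a}) \<in> X" by (rule full) (use a fN cN in auto)
    moreover have "insert r \<tau> \<subseteq> insert r (N - {a})" using psub a by blast
    ultimately show ?thesis by (rule npm_down[OF X])
  qed
qed

text \<open>The d-faces on \<open>S\<close> already provide both facets at each of their ridges, so
  no ridge leads out of them, and strong connectedness excludes any other facet.\<close>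

lemma npm_eq_simplex_boundary:
  assumes X: "normal_pseudomanifold d X" and S: "finite S" "card S = d + 2"
    and sub: "\<And>\<phi>. \<phi> \<subseteq> S \<Longrightarrow> card \<phi> = d + 1 \<Longrightarrow> \<phi> \<in> X"
  shows "X = Pow S - {S}"
proof -
  let ?F = "{\<phi>. \<phi> \<subseteq> S \<and> card \<phi> = d + 1}"
  have closed: "ridge_closed d X ?F"
    unfolding ridge_closed_def
  proof (intro ballI impI)
    fix s t assume st: "s \<in> ?F" "t \<in> X" "card t = d + 1" "card (s \<inter> t) = d" and sX: "s \<in> X"
    let ?\<rho> = "s \<inter> t"
    have \<rho>: "?\<rho> \<subseteq> S" "finite ?\<rho>" using st S finite_subset by blast+
    have "?\<rho> \<in> X" using npm_down[OF X sX] by blast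
    then have two: "card {\<phi> \<in> X. card \<phi> = d + 1 \<and> ?\<rho> \<subseteq> \<phi>} = 2" (is "card ?G = 2")
      using npm_ridge[OF X _ st(4)] by simp
    have fG: "finite ?G" using npm_finite(1)[OF X] by simp
    obtain x y where xy: "S - ?\<rho> = {x, y}" "x \<noteq> y"
      by (rule card_2_eq_cases[OF S(1) \<rho>(1)]) (use S st in auto)
    have n: "x \<in> S" "y \<in> S" "x \<notin> ?\<rho>" "y \<notin> ?\<rho>" using xy by blast+
    have F: "insert x ?\<rho> \<in> ?F" "insert y ?\<rho> \<in> ?F"
      using n \<rho> st(4) by auto
    then have "{insert x ?\<rho>, insert y ?\<rho>} \<subseteq> ?G" using sub by blast
    moreover have "insert x ?\<rho> \<noteq> insert y ?\<rho>" using n xy(2) by blast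
    then have "card {insert x ?\<rho>, insert y ?\<rho>} = 2" by simp
    then have "card {insert x ?\<rho>, insert y ?\<rho>} = card ?G" unfolding two .
    ultimately have "{insert x ?\<rho>, insert y ?\<rho>} = ?G"
      by (rule card_subset_eq[OF fG])
    moreover have "t \<in> ?G" using st by simp
    ultimately have "t = insert x ?\<rho> \<or> t = insert y ?\<rho>" by (metis (no_types, lifting) insertE singletonD)
    then show "t \<in> ?F" using F by metis
  qed
  have facet: "S - {a} \<in> ?F" if "a \<in> S" for a using that S by auto
  have "S \<noteq> {}" using S(2) by auto
  then obtain a where "a \<in> S" by blast
  then have s: "S - {a} \<in> ?F" by (rule facet)
  then have sX: "S - {a} \<in> X" "card (S - {a}) = d + 1" using sub by blast+
  have all: "t \<in> ?F" if "t \<in> X" "card t = d + 1" for t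
    by (rule npm_strongly_connected[OF X closed s sX that])
  show ?thesis
  proof
    show "X \<subseteq> Pow S - {S}"
    proof
      fix \<alpha> assume "\<alpha> \<in> X"
      then obtain \<phi> where p: "\<phi> \<in> X" "\<alpha> \<subseteq> \<phi>" "card \<phi> = d + 1" using npm_extend[OF X] by blast
      then have "\<phi> \<subseteq> S" using all by blast
      moreover have "\<phi> \<noteq> S" using p(3) S(2) by auto
      ultimately show "\<alpha> \<in> Pow S - {S}" using p(2) by blast
    qed
    show "Pow S - {S} \<subseteq> X"
    proof
      fix \<alpha> assume "\<alpha> \<in> Pow S - {S}"
      then obtain a where a: "a \<in> S" "\<alpha> \<subseteq> S - {a}" by blast
      then have "S - {a} \<in> X" using facet[OF a(1)] sub by blast
      then show "\<alpha> \<in> X" using a(2) by (rule npm_down[OF X])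
    qed
  qed
qed

lemma minimal_edges_stacked:
  assumes d: "3 \<le> d" and "normal_pseudomanifold d X" "minimal_edges d X"
  shows "stacked_sphere d X"
  using assms(2-)
proof (induction "card (\<Union>X)" arbitrary: X rule: less_induct)
  case less
  note X = less.prems(1) and min = less.prems(2) and sc = npm_simplicial[OF less.prems(1)]
  obtain r where r: "r \<in> \<Union>X" "\<And>x y. {r, x} \<in> X \<Longrightarrow> {r, y} \<in> X \<Longrightarrow> {x, y} \<in> X"
    by (rule minimal_edges_exists_simplicial_vertex[OF d X min]) blast
  define N where "N = \<Union>(link X {r})"
  have cN: "card N = d + 1" and full: "\<And>\<tau>. \<tau> \<subset> N \<Longrightarrow> insert r \<tau> \<in> X"
    using minimal_edges_simplicial_vertex[OF d X min r] unfolding N_def by blast+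
  have fN: "finite N" using finite_vertices[OF simplicial_complex_link[OF sc]] by (simp add: N_def)
  have rN: "r \<notin> N" using notin_vertices_link by (simp add: N_def)
  have faceN: "\<beta> - {r} \<subseteq> N" if "\<beta> \<in> X" "r \<in> \<beta>" for \<beta>
  proof -
    have "\<beta> - {r} \<in> link X {r}" using that by (simp add: in_link_vertex[OF sc] insert_absorb)
    then show ?thesis by (auto simp: N_def)
  qed
  show ?case
  proof (cases "N \<in> X")
    case True
    have "X = Pow (insert r N) - {insert r N}"
    proof (rule npm_eq_simplex_boundary[OF X])
      show "finite (insert r N)" "card (insert r N) = d + 2" using fN rN cN by simp_all
      fix \<phi> assume p: "\<phi> \<subseteq> insert r N" "card \<phi> = d + 1"
      have fp: "finite \<phi>" using p fN by (meson finite_insert finite_subset)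
      show "\<phi> \<in> X"
      proof (cases "r \<in> \<phi>")
        case True
        then have "card (\<phi> - {r}) < card N" using p fp cN by simp
        then have "\<phi> - {r} \<subset> N" using p(1) by (intro psubset_if_card_less) blast
        then show ?thesis using full[of "\<phi> - {r}"] True by (simp add: insert_absorb)
      next
        case False
        then have "\<phi> = N" using p cN fN by (intro card_subset_eq) auto
        then show ?thesis using \<open>N \<in> X\<close> by simp
      qed
    qed
    then show ?thesis using stacked_sphere.base[of "insert r N" d] fN rN cN by simp
  next
    case False
    \<comment> \<open>Delete \<open>r\<close> and fill the hole with \<open>N\<close>, the inverse
      of starring \<open>r\<close> in \<open>N\<close>.\<close>
    let ?X0 = "insert N {\<beta> \<in> X. r \<notin> \<beta>}"
    have X_eq: "X = star_face ?X0 N r"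
    proof
      show "X \<subseteq> star_face ?X0 N r"
      proof
        fix \<beta> assume b: "\<beta> \<in> X"
        show "\<beta> \<in> star_face ?X0 N r"
        proof (cases "r \<in> \<beta>")
          case True
          \<comment> \<open>Otherwise \<open>N\<close> would be a face of \<open>X\<close>, contrary
            to the case assumption.\<close>
          have "\<beta> - {r} \<noteq> N" using npm_down[OF X b, of "\<beta> - {r}"] False by blast
          then have "\<beta> - {r} \<subset> N" using faceN[OF b True] by blast
          moreover have "\<beta> = insert r (\<beta> - {r})" using True by blast
          ultimately show ?thesis unfolding star_face_def by blast
        next
          case r\<beta>: False
          then show ?thesis using b False unfolding star_face_def by blast
        qed
      qed
      show "star_face ?X0 N r \<subseteq> X" using full unfolding star_face_def by blast
    qed
    have faces: "\<tau> \<in> X \<and> r \<notin> \<tau>" if "\<tau> \<subset> N" for \<tau>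
      using npm_down[OF X full[OF that], of \<tau>] rN that by blast
    have sc0: "simplicial_complex ?X0"
      unfolding simplicial_complex_def
    proof (intro conjI ballI allI impI)
      show "finite ?X0" using npm_finite(1)[OF X] by simp
      fix \<sigma> assume s: "\<sigma> \<in> ?X0"
      then show "finite \<sigma>" using fN npm_finite(2)[OF X] by blast
      fix \<tau> assume t: "\<tau> \<subseteq> \<sigma>"
      show "\<tau> \<in> ?X0"
      proof (cases "\<sigma> = N")
        case True
        then show ?thesis using t faces[of \<tau>] by blast
      next
        case False
        then have "\<sigma> \<in> X" "r \<notin> \<sigma>" using s by blast+
        then show ?thesis using t npm_down[OF X, of \<sigma> \<tau>] by blast
      qed
    qed
    have r0: "r \<notin> \<Union>?X0" using rN by blast
    have dim0: "card \<alpha> \<le> d + 1" if "\<alpha> \<in> ?X0" for \<alpha>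
      using that cN npm_card_le[OF X] by auto
    have d1: "1 \<le> d" "2 \<le> d" using d by simp_all
    have X0: "normal_pseudomanifold d ?X0"
      using npm_star_face_iff[OF d1(1) sc0 insertI1 cN r0 dim0] X X_eq by simp
    have min0: "minimal_edges d ?X0"
      using minimal_edges_star_face_iff[OF d1(2) sc0 insertI1 cN r0 dim0] min X_eq by simp
    have "\<Union>X = insert r (\<Union>?X0)"
      using vertices_star_face[OF d1(1) sc0 insertI1 cN r0 dim0] X_eq by simp
    then have "card (\<Union>?X0) < card (\<Union>X)"
      using r0 finite_vertices[OF sc0] by (simp del: Union_insert)
    then have "stacked_sphere d ?X0" using X0 min0 by (rule less.hyps)
    moreover have N: "N \<in> facets ?X0" using pure_dim_facets[OF npm_pure[OF X0]] cN by simp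
    moreover have "r \<notin> vertices ?X0" using r0 by (simp add: vertices_def)
    ultimately have "stacked_sphere d (star_in ?X0 N r d)" by (rule stacked_sphere.step)
    then show ?thesis using star_in_eq_star_face[OF npm_pure[OF X0] N r0] X_eq by simp
  qed
qed

theorem theorem7p8:
  shows "(\<forall>d \<ge> 2. \<forall>X :: 'a set set. normal_pseudomanifold d X \<longrightarrow> rigid (d + 1) d X)
       \<and> (\<forall>d \<ge> 3. \<forall>X :: 'a set set. stacked_sphere d X \<longleftrightarrow>
            (normal_pseudomanifold d X \<and> minimally_rigid (d + 1) d X))"
proof (intro conjI allI impI)
  fix d :: nat and X :: "'a set set"
  assume "2 \<le> d" "normal_pseudomanifold d X"
  then show "rigid (d + 1) d X" by (rule npm_rigid)
next
  fix d :: nat and X :: "'a set set"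
  assume "3 \<le> d"
  then show "stacked_sphere d X \<longleftrightarrow> normal_pseudomanifold d X \<and> minimally_rigid (d + 1) d X"
    using stacked_sphere_npm_minimal[of d X] minimal_edges_stacked[of d X] npm_rigid[of d X]
      minimally_rigid_iff[of d X] by linarith
qed

end
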